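(* Let $\mathcal{P}$ be a non-trivial, hereditary and additive hypergraph property with $d(\mathcal{P})=r$, let $H$ be a connected hypergraph, and let $L$ be a list-assignment for $H$ with $r|L(v)|\ge d_H(v)$ for all $v\in V(H)$. If $H$ is not $(\mathcal{P},L)$-colorable, then every block $B$ of $H$ is a brick, or $B\in\mathcal{F}(\mathcal{P})$ and $B$ is $r$-regular, or $B\in\mathcal{P}$ and $\Delta(B)\le r$.
   Context: A hypergraph is a triple $H=(V,E,i)$ with $V,E$ finite and $i:E\to 2^V$, $|i(e)|\ge 2$ (parallel edges allowed). $H[X]$ is the induced subhypergraph on $X$ (edges with $i(e)\subseteq X$), $H-v=H[V(H)\setminus\{v\}]$. $d_H(v)$ is the number of edges containing $v$, $\delta,\Delta$ minimum/maximum degree; $r$-regular means all degrees equal $r$. A hyperpath is an alternating sequence of distinct vertices and distinct edges with consecutive vertices contained in the edge between them; $H$ is connected if any two vertices are joined by one. A separating vertex $v$ of $H$ is one such that $H$ is the union of two induced subhypergraphs meeting exactly in $\{v\}$, each with at least $2$ vertices; a block is a maximal connected subhypergraph without separating vertex. A brick is $tC_n$ ($t\ge1$, $n\ge3$ odd) or $tK_n$ ($t,n\ge1$), where $tG$ replaces each edge of the simple graph $G$ by $t$ parallel edges, $K_n$ is complete, $C_n$ is a cycle with edges of size 2. A hypergraph property is an isomorphism-closed class; hereditary: closed under induced subhypergraphs; non-trivial: contains a non-empty hypergraph but not all hypergraphs; additive: closed under vertex-disjoint unions. $\mathcal{F}(\mathcal{P})$ is the class of $H\notin\mathcal{P}$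 with $H-v\in\mathcal{P}$ for all $v$; $d(\mathcal{P})=\min\{\delta(H):H\in\mathcal{F}(\mathcal{P})\}$. A list-assignment is $L:V(H)\to 2^C$; a $(\mathcal{P},L)$-coloring is $\varphi:V(H)\to C$ with $\varphi(v)\in L(v)$ and $H[\varphi^{-1}(c)]\in\mathcal{P}$ for all $c\in C$. *)

theory Defs
  imports "HOL-Library.Infinite_Typeclass"
begin

record ('v, 'e) pre_hypergraph =
  verts :: "'v set"
  edges :: "'e set"
  inc :: "'e \<Rightarrow> 'v set"

(* The values of inc outside edges are irrelevant: no notion below depends on them. *)
definition hypergraph :: "('v, 'e) pre_hypergraph \<Rightarrow> bool" where
  "hypergraph H \<longleftrightarrow> finite (verts H) \<and> finite (edges H) \<and>
     (\<forall>e\<in>edges H. inc H e \<subseteq> verts H \<and> 2 \<le> card (inc H e))"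

definition hg_iso :: "('v, 'e) pre_hypergraph \<Rightarrow> ('w, 'f) pre_hypergraph \<Rightarrow> bool" where
  "hg_iso G H \<longleftrightarrow> (\<exists>f g. bij_betw f (verts G) (verts H) \<and> bij_betw g (edges G) (edges H) \<and>
     (\<forall>e\<in>edges G. inc H (g e) = f ` inc G e))"

definition subhypergraph :: "('v, 'e) pre_hypergraph \<Rightarrow> ('v, 'e) pre_hypergraph \<Rightarrow> bool" where
  "subhypergraph G H \<longleftrightarrow> hypergraph G \<and> verts G \<subseteq> verts H \<and> edges G \<subseteq> edges H \<and>
     (\<forall>e\<in>edges G. inc G e = inc H e)"

definition induced :: "('v, 'e) pre_hypergraph \<Rightarrow> 'v set \<Rightarrow> ('v, 'e) pre_hypergraph" where
  "induced H X = \<lparr>verts = verts H \<inter> X, edges = {e \<in> edges H. inc H e \<subseteq> X}, inc = inc H\<rparr>"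

definition del_vert :: "('v, 'e) pre_hypergraph \<Rightarrow> 'v \<Rightarrow> ('v, 'e) pre_hypergraph" where
  "del_vert H v = induced H (verts H - {v})"

(* H is the union of G1 and G2.  This is a relation since the union of two hypergraphs only
   makes sense if their incidence functions agree on common edges; when the vertex sets are
   disjoint, it forces the edge sets to be disjoint as well. *)
definition is_union ::
  "('v, 'e) pre_hypergraph \<Rightarrow> ('v, 'e) pre_hypergraph \<Rightarrow> ('v, 'e) pre_hypergraph \<Rightarrow> bool" where
  "is_union H G1 G2 \<longleftrightarrow> subhypergraph G1 H \<and> subhypergraph G2 H \<and>
     verts H = verts G1 \<union> verts G2 \<and> edges H = edges G1 \<union> edges G2"

definition degree :: "('v, 'e) pre_hypergraph \<Rightarrow> 'v \<Rightarrow> nat" where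
  "degree H v = card {e \<in> edges H. v \<in> inc H e}"

definition min_degree :: "('v, 'e) pre_hypergraph \<Rightarrow> nat" where
  "min_degree H = Min (degree H ` verts H)"

definition max_degree :: "('v, 'e) pre_hypergraph \<Rightarrow> nat" where
  "max_degree H = Max (degree H ` verts H)"

definition regular :: "nat \<Rightarrow> ('v, 'e) pre_hypergraph \<Rightarrow> bool" where
  "regular r H \<longleftrightarrow> (\<forall>v\<in>verts H. degree H v = r)"

definition hyperpath :: "('v, 'e) pre_hypergraph \<Rightarrow> 'v list \<Rightarrow> 'e list \<Rightarrow> bool" where
  "hyperpath H vs es \<longleftrightarrow> length vs = Suc (length es) \<and>
     set vs \<subseteq> verts H \<and> set es \<subseteq> edges H \<and> distinct vs \<and> distinct es \<and>
     (\<forall>i<length es. {vs ! i, vs ! Suc i} \<subseteq> inc H (es ! i))"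

definition hg_connected :: "('v, 'e) pre_hypergraph \<Rightarrow> bool" where
  "hg_connected H \<longleftrightarrow> (\<forall>u\<in>verts H. \<forall>v\<in>verts H.
     \<exists>vs es. hyperpath H vs es \<and> hd vs = u \<and> last vs = v)"

definition separating_vertex :: "('v, 'e) pre_hypergraph \<Rightarrow> 'v \<Rightarrow> bool" where
  "separating_vertex H v \<longleftrightarrow> (\<exists>X Y. X \<subseteq> verts H \<and> Y \<subseteq> verts H \<and>
     is_union H (induced H X) (induced H Y) \<and> X \<inter> Y = {v} \<and> 2 \<le> card X \<and> 2 \<le> card Y)"

definition nonseparable :: "('v, 'e) pre_hypergraph \<Rightarrow> bool" where
  "nonseparable H \<longleftrightarrow> hg_connected H \<and> \<not> (\<exists>v. separating_vertex H v)"

definition is_block :: "('v, 'e) pre_hypergraph \<Rightarrow> ('v, 'e) pre_hypergraph \<Rightarrow> bool" where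
  "is_block H B \<longleftrightarrow> subhypergraph B H \<and> nonseparable B \<and>
     (\<forall>B'. subhypergraph B' H \<and> nonseparable B' \<and> subhypergraph B B' \<longrightarrow> subhypergraph B' B)"

definition complete_graph :: "nat \<Rightarrow> (nat, nat set) pre_hypergraph" where
  "complete_graph n = \<lparr>verts = {..<n}, edges = {e. e \<subseteq> {..<n} \<and> card e = 2}, inc = (\<lambda>e. e)\<rparr>"

definition cycle_graph :: "nat \<Rightarrow> (nat, nat set) pre_hypergraph" where
  "cycle_graph n =
     \<lparr>verts = {..<n}, edges = {{i, Suc i mod n} | i. i < n}, inc = (\<lambda>e. e)\<rparr>"

definition multiple :: "nat \<Rightarrow> ('v, 'e) pre_hypergraph \<Rightarrow> ('v, 'e \<times> nat) pre_hypergraph" where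
  "multiple t G = \<lparr>verts = verts G, edges = edges G \<times> {..<t}, inc = (\<lambda>(e, j). inc G e)\<rparr>"

definition brick :: "('v, 'e) pre_hypergraph \<Rightarrow> bool" where
  "brick B \<longleftrightarrow>
     (\<exists>t n. 1 \<le> t \<and> 3 \<le> n \<and> odd n \<and> hg_iso B (multiple t (cycle_graph n))) \<or>
     (\<exists>t n. 1 \<le> t \<and> 1 \<le> n \<and> hg_iso B (multiple t (complete_graph n)))"

(* A property is a set of hypergraphs over fixed vertex and edge types.  When both types are
   infinite, every finite hypergraph has an isomorphic copy over them, so that isomorphism-closed
   sets over these types represent exactly the isomorphism-closed classes of hypergraphs. *)
definition hypergraph_property :: "('v, 'e) pre_hypergraph set \<Rightarrow> bool" where
  "hypergraph_property P \<longleftrightarrow> (\<forall>H\<in>P. hypergraph H) \<and>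
     (\<forall>G\<in>P. \<forall>H. hypergraph H \<and> hg_iso G H \<longrightarrow> H \<in> P)"

definition nontrivial :: "('v, 'e) pre_hypergraph set \<Rightarrow> bool" where
  "nontrivial P \<longleftrightarrow> (\<exists>H\<in>P. verts H \<noteq> {}) \<and> (\<exists>H. hypergraph H \<and> H \<notin> P)"

definition hereditary :: "('v, 'e) pre_hypergraph set \<Rightarrow> bool" where
  "hereditary P \<longleftrightarrow> (\<forall>H\<in>P. \<forall>X\<subseteq>verts H. induced H X \<in> P)"

definition hg_additive :: "('v, 'e) pre_hypergraph set \<Rightarrow> bool" where
  "hg_additive P \<longleftrightarrow> (\<forall>G1\<in>P. \<forall>G2\<in>P. \<forall>H. hypergraph H \<and> is_union H G1 G2 \<and>
     verts G1 \<inter> verts G2 = {} \<longrightarrow> H \<in> P)"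

definition critical_class :: "('v, 'e) pre_hypergraph set \<Rightarrow> ('v, 'e) pre_hypergraph set" where
  "critical_class P = {H. hypergraph H \<and> H \<notin> P \<and> (\<forall>v\<in>verts H. del_vert H v \<in> P)}"

definition critical_degree :: "('v, 'e) pre_hypergraph set \<Rightarrow> nat" where
  "critical_degree P = (LEAST d. \<exists>H\<in>critical_class P. min_degree H = d)"

definition list_assignment ::
  "('v, 'e) pre_hypergraph \<Rightarrow> 'c set \<Rightarrow> ('v \<Rightarrow> 'c set) \<Rightarrow> bool" where
  "list_assignment H C L \<longleftrightarrow> (\<forall>v\<in>verts H. L v \<subseteq> C)"

definition is_list_coloring ::
  "('v, 'e) pre_hypergraph set \<Rightarrow> ('v, 'e) pre_hypergraph \<Rightarrow> 'c set \<Rightarrow> ('v \<Rightarrow> 'c set) \<Rightarrow>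
     ('v \<Rightarrow> 'c) \<Rightarrow> bool" where
  "is_list_coloring P H C L \<phi> \<longleftrightarrow> (\<forall>v\<in>verts H. \<phi> v \<in> L v) \<and>
     (\<forall>c\<in>C. induced H {v \<in> verts H. \<phi> v = c} \<in> P)"

definition list_colorable ::
  "('v, 'e) pre_hypergraph set \<Rightarrow> ('v, 'e) pre_hypergraph \<Rightarrow> 'c set \<Rightarrow> ('v \<Rightarrow> 'c set) \<Rightarrow> bool" where
  "list_colorable P H C L \<longleftrightarrow> (\<exists>\<phi>. is_list_coloring P H C L \<phi>)"

(* r * |A| >= d, where an infinite A (whose card is 0 by convention) satisfies the bound, in
   accordance with its actual cardinality; the factor r >= 1 is automatic for the critical
   degree of a non-trivial, hereditary and additive property. *)
definition list_size_ge :: "nat \<Rightarrow> 'c set \<Rightarrow> nat \<Rightarrow> bool" where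
  "list_size_ge r A d \<longleftrightarrow> (finite A \<longrightarrow> d \<le> r * card A)"

end

theory Submission
  imports Defs
begin

text \<open>Give every vertex \<open>v\<close> the budget \<open>f c v = r\<close> for the colours \<open>c\<close> of (a finite part of) its list and
  \<open>f c v = 0\<close> otherwise. If in each colour class every non-empty vertex set \<open>T\<close> contains a vertex whose
  degree within \<open>T\<close> is below its budget, then no class contains a critical subhypergraph, so
  the colouring is a \<open>(P, L)\<close>-colouring. Colouring everything outside a block greedily reduces the problem to
  a non-separable hypergraph with vertex-dependent budgets summing up to at least the degrees.

  There, consider colourings of all vertices but one, the hole. Non-colourability forces every edge at
  the hole to be monochromatic up to the hole, with exactly \<open>f c v\<close> edges in colour \<open>c\<close>, and lets the hole slide
  along edges, moving colours backwards. Sliding it around shows that all vertices have the same colours with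
  positive budget. If there is only one such colour, the degrees in the block are at most \<open>r\<close>.
  Otherwise all edges have size two, and comparing colour counts before and after a round trip of the hole
  forces a complete graph or an odd cycle with constant edge multiplicity.\<close>

section \<open>Colourings with vertex-dependent budgets\<close>

text \<open>Budgets replace lists because colouring the outside of a block takes away single edges:
  a vertex loses one unit of colour \<open>c\<close> for each edge leaving the block whose outer
  part is coloured \<open>c\<close>, and what is left of \<open>r\<close> need be neither 0 nor
  \<open>r\<close>. So the block problem has to be solved for arbitrary \<open>f\<close>.

  All equations between multiplicities have one source: with the hole at \<open>v\<close>, the
  number of edges at \<open>v\<close> in colour \<open>c\<close> is \<open>f c v\<close>, whatever
  the colouring. Two colourings with the same hole that differ at few of its neighbours can thus be
  compared. Cliques grow from a triangle with two colours beside the hole. If there is none, an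
  induced cycle through the hole appears on which colours alternate; it is odd because the two ends
  of the alternating path have different colours.

  The obstacle is to show that a maximal clique or a ring is everything: the colours on an ear
  leading out of it and back are unknown. The same ear trip is therefore made from several starting
  colourings at once, so that the unknown colours agree and drop out of the comparison.\<close>

locale weighted_hypergraph =
  fixes V :: "'v set" and E :: "'e set" and I :: "'e \<Rightarrow> 'v set"
    and K :: "'c set" and f :: "'c \<Rightarrow> 'v \<Rightarrow> nat"
  assumes finV: "finite V" and finE: "finite E" and finK: "finite K"
    and inc_V: "e \<in> E \<Longrightarrow> I e \<subseteq> V"
    and inc_card: "e \<in> E \<Longrightarrow> 2 \<le> card (I e)"
    and f_outside: "c \<notin> K \<Longrightarrow> f c v = 0"
    and budget: "v \<in> V \<Longrightarrow> card {e \<in> E. v \<in> I e} \<le> (\<Sum>c\<in>K. f c v)"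
    and connected: "X \<subseteq> V \<Longrightarrow> X \<noteq> {} \<Longrightarrow> X \<noteq> V \<Longrightarrow> \<exists>e\<in>E. I e \<inter> X \<noteq> {} \<and> I e - X \<noteq> {}"
begin

definition dg :: "'v set \<Rightarrow> 'v \<Rightarrow> nat" where
  "dg T v = card {e \<in> E. v \<in> I e \<and> I e \<subseteq> T}"

text \<open>Strict degeneracy with a variable bound. The instance \<open>T = {v}\<close> already
  forces \<open>f c v > 0\<close>, so a zero budget is how a list forbids a colour.\<close>

definition degenerate :: "'c \<Rightarrow> 'v set \<Rightarrow> bool" where
  "degenerate c S \<longleftrightarrow> (\<forall>T\<subseteq>S. T \<noteq> {} \<longrightarrow> (\<exists>v\<in>T. dg T v < f c v))"

definition proper :: "('v \<Rightarrow> 'c) \<Rightarrow> 'v set \<Rightarrow> bool" where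
  "proper \<phi> X \<longleftrightarrow> (\<forall>c. degenerate c {v \<in> X. \<phi> v = c})"

definition adj :: "'v \<Rightarrow> 'v \<Rightarrow> bool" where
  "adj u v \<longleftrightarrow> u \<noteq> v \<and> (\<exists>e\<in>E. u \<in> I e \<and> v \<in> I e)"

lemma adj_sym: "adj u v \<Longrightarrow> adj v u"
  by (auto simp: adj_def)

lemma adj_in_V: "adj u v \<Longrightarrow> u \<in> V" "adj u v \<Longrightarrow> v \<in> V"
  using inc_V by (auto simp: adj_def)

lemma dg_mono: "S \<subseteq> T \<Longrightarrow> dg S v \<le> dg T v"
  unfolding dg_def by (rule card_mono) (use finE in auto)

lemma inc_other:
  assumes "e \<in> E" obtains w where "w \<in> I e" "w \<noteq> v"
proof -
  have "\<not> I e \<subseteq> {v}"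
    using inc_card[OF assms] card_mono[of "{v}" "I e"] by auto
  then show ?thesis using that by blast
qed

text \<open>The bad sets of the individual colours use up pairwise disjoint sets of edges at \<open>u\<close>, so the
  budget is exhausted exactly.\<close>

lemma saturated:
  assumes \<phi>: "proper \<phi> X" and u: "u \<in> V" "u \<notin> X"
    and stuck: "\<And>c. \<not> proper (\<phi>(u := c)) (insert u X)"
  shows "\<forall>e\<in>E. u \<in> I e \<longrightarrow> (\<exists>c. I e \<subseteq> insert u {v \<in> X. \<phi> v = c})"
    and "dg (insert u {v \<in> X. \<phi> v = c}) u = f c u"
proof -
  define A where "A c = {e \<in> E. u \<in> I e \<and> I e \<subseteq> insert u {v \<in> X. \<phi> v = c}}" for c
  have finA: "finite (A c)" for c using finE by (auto simp: A_def)
  have cardA: "card (A c) = dg (insert u {v \<in> X. \<phi> v = c}) u" for c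
    by (simp add: A_def dg_def)
  \<comment> \<open>Giving \<open>u\<close> the colour \<open>c\<close> changes the class of
    \<open>c\<close> only, so a set violating degeneracy lies in that class and contains
    \<open>u\<close>; its edges at \<open>u\<close> belong to \<open>A c\<close>.\<close>
  have le: "f c u \<le> card (A c)" for c
  proof -
    obtain c' where "\<not> degenerate c' {v \<in> insert u X. (\<phi>(u := c)) v = c'}"
      using stuck[of c] unfolding proper_def by blast
    moreover have "{v \<in> insert u X. (\<phi>(u := c)) v = c'} = {v \<in> X. \<phi> v = c'}" if "c' \<noteq> c"
      using that u by auto
    moreover have "degenerate c' {v \<in> X. \<phi> v = c'}" using \<phi> by (simp add: proper_def)
    ultimately have "c' = c" by metis
    with \<open>\<not> degenerate c' _\<close> obtain T where
      T: "T \<subseteq> {v \<in> insert u X. (\<phi>(u := c)) v = c}" "T \<noteq> {}" "\<forall>v\<in>T. f c v \<le> dg T v"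
      unfolding degenerate_def by (metis linorder_not_less)
    have "{v \<in> insert u X. (\<phi>(u := c)) v = c} = insert u {v \<in> X. \<phi> v = c}"
      using u by auto
    then have T': "T \<subseteq> insert u {v \<in> X. \<phi> v = c}" using T by simp
    have "u \<in> T"
    proof (rule ccontr)
      assume "u \<notin> T"
      then have "T \<subseteq> {v \<in> X. \<phi> v = c}" using T' by auto
      moreover have "degenerate c {v \<in> X. \<phi> v = c}" using \<phi> by (simp add: proper_def)
      ultimately show False using T unfolding degenerate_def by (meson linorder_not_less)
    qed
    then show ?thesis using T dg_mono[OF T', of u] cardA by (metis le_trans)
  qed
  have disj: "A c \<inter> A d = {}" if "c \<noteq> d" for c d
  proof -
    have False if "e \<in> A c" "e \<in> A d" for e
    proof -
      have "e \<in> E" using that by (simp add: A_def)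
      then obtain w where "w \<in> I e" "w \<noteq> u" by (rule inc_other)
      then show False using that \<open>c \<noteq> d\<close> by (auto simp: A_def)
    qed
    then show ?thesis by auto
  qed
  have sumA: "card (\<Union>c\<in>K. A c) = (\<Sum>c\<in>K. card (A c))"
    by (rule card_UN_disjoint) (use finK finA disj in auto)
  have sub: "(\<Union>c\<in>K. A c) \<subseteq> {e \<in> E. u \<in> I e}" by (auto simp: A_def)
  have fin: "finite {e \<in> E. u \<in> I e}" using finE by auto
  have 1: "(\<Sum>c\<in>K. f c u) \<le> (\<Sum>c\<in>K. card (A c))" by (rule sum_mono) (rule le)
  have 2: "card (\<Union>c\<in>K. A c) \<le> card {e \<in> E. u \<in> I e}" by (rule card_mono[OF fin sub])
  have eq: "(\<Union>c\<in>K. A c) = {e \<in> E. u \<in> I e}"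
    by (rule card_subset_eq[OF fin sub]) (use 1 2 sumA budget[OF u(1)] in linarith)
  have sumeq: "(\<Sum>c\<in>K. card (A c)) = (\<Sum>c\<in>K. f c u)"
    using 1 2 sumA budget[OF u(1)] by linarith
  show "\<forall>e\<in>E. u \<in> I e \<longrightarrow> (\<exists>c. I e \<subseteq> insert u {v \<in> X. \<phi> v = c})"
  proof (intro ballI impI)
    fix e assume "e \<in> E" "u \<in> I e"
    then have "e \<in> (\<Union>c\<in>K. A c)" using eq by auto
    then show "\<exists>c. I e \<subseteq> insert u {v \<in> X. \<phi> v = c}" by (auto simp: A_def)
  qed
  have "card (A c) = f c u"
  proof (cases "c \<in> K")
    case True
    show ?thesis
    proof (rule ccontr)
      assume "card (A c) \<noteq> f c u"
      then have "f c u < card (A c)" using le[of c] by simp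
      then have "(\<Sum>c\<in>K. f c u) < (\<Sum>c\<in>K. card (A c))"
        using finK True le by (intro sum_strict_mono_ex1) auto
      then show False using sumeq by simp
    qed
  next
    case False
    have "A c = {}"
    proof -
      have False if "e \<in> A c" for e
      proof -
        have "e \<in> (\<Union>c\<in>K. A c)" using that eq by (auto simp: A_def)
        then obtain d where "d \<in> K" "e \<in> A d" by auto
        then show False using disj[of c d] that False by auto
      qed
      then show ?thesis by auto
    qed
    then show ?thesis using f_outside[OF False] by simp
  qed
  then show "dg (insert u {v \<in> X. \<phi> v = c}) u = f c u" using cardA by simp
qed

text \<open>The edge \<open>e\<close> has an uncoloured vertex besides \<open>u\<close>, so it lies
  in no colour class together with \<open>u\<close>; by \<open>saturated\<close>, a vertex without a
  usable colour has no such edge.\<close>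

lemma greedy_step:
  assumes "proper \<phi> X" "u \<in> V" "u \<notin> X" "e \<in> E" "u \<in> I e" "\<not> I e \<subseteq> insert u X"
  shows "\<exists>c. proper (\<phi>(u := c)) (insert u X)"
proof (rule ccontr)
  assume "\<nexists>c. proper (\<phi>(u := c)) (insert u X)"
  then have "\<exists>c. I e \<subseteq> insert u {v \<in> X. \<phi> v = c}"
    using saturated(1)[OF assms(1,2,3)] assms(4,5) by blast
  then show False using assms(6) by auto
qed

text \<open>The induction enlarges \<open>Y\<close> by a vertex \<open>u\<close> on an edge meeting
  \<open>Y\<close>. When \<open>u\<close> is coloured last, that edge still reaches the uncoloured
  set, so \<open>greedy_step\<close> applies.\<close>

lemma greedy:
  assumes "Y \<subseteq> V" "Y \<noteq> {}"
  shows "\<exists>\<phi>. proper \<phi> (V - Y)"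
  using assms
proof (induction "card (V - Y)" arbitrary: Y rule: less_induct)
  case less
  show ?case
  proof (cases "Y = V")
    case True
    then show ?thesis by (auto simp: proper_def degenerate_def)
  next
    case False
    obtain e where e: "e \<in> E" "I e \<inter> Y \<noteq> {}" "I e - Y \<noteq> {}"
      using connected[OF less.prems False] by auto
    then obtain u where u: "u \<in> I e" "u \<notin> Y" by auto
    have uV: "u \<in> V" using u e inc_V by auto
    have "V - insert u Y \<subset> V - Y" using u uV by auto
    then have "card (V - insert u Y) < card (V - Y)" using finV by (intro psubset_card_mono) auto
    then obtain \<phi> where \<phi>: "proper \<phi> (V - insert u Y)"
      using less.hyps[of "insert u Y"] less.prems uV by auto
    have "\<exists>c. proper (\<phi>(u := c)) (insert u (V - insert u Y))"
      using \<phi> uV by (rule greedy_step) (use e u in auto)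
    moreover have "insert u (V - insert u Y) = V - Y" using u uV by auto
    ultimately show ?thesis by auto
  qed
qed

end

section \<open>Sliding the hole in a non-separable hypergraph\<close>

text \<open>Absence of a separating vertex in cut form. The crossing edge may contain
  \<open>v\<close>: removing \<open>v\<close> shrinks edges instead of discarding them, which
  matches a union of two induced subhypergraphs meeting in \<open>v\<close>.\<close>

locale noncolorable_block = weighted_hypergraph V E I K f
  for V :: "'v set" and E :: "'e set" and I :: "'e \<Rightarrow> 'v set"
    and K :: "'c set" and f :: "'c \<Rightarrow> 'v \<Rightarrow> nat" +
  assumes nonseparable:
      "v \<in> V \<Longrightarrow> X \<subseteq> V - {v} \<Longrightarrow> X \<noteq> {} \<Longrightarrow> X \<noteq> V - {v} \<Longrightarrow>
        \<exists>e\<in>E. I e \<inter> X \<noteq> {} \<and> I e - X - {v} \<noteq> {}"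
    and noncolorable: "\<not> proper \<phi> V"
begin

text \<open>Colourings are total functions, so the value \<open>\<phi> v\<close> at the hole is
  arbitrary and carries no meaning.\<close>

definition good :: "('v \<Rightarrow> 'c) \<Rightarrow> 'v \<Rightarrow> bool" where
  "good \<phi> v \<longleftrightarrow> v \<in> V \<and> proper \<phi> (V - {v})"

lemma good_exists: "v \<in> V \<Longrightarrow> \<exists>\<phi>. good \<phi> v"
  using greedy[of "{v}"] by (auto simp: good_def)

lemma good_in_V: "good \<phi> v \<Longrightarrow> v \<in> V"
  by (simp add: good_def)

lemma good_stuck:
  assumes "good \<phi> v" shows "\<not> proper (\<phi>(v := c)) (insert v (V - {v}))"
  using noncolorable assms by (simp add: good_def insert_absorb)

lemma good_edge_mono:
  assumes "good \<phi> v" "e \<in> E" "v \<in> I e" "x \<in> I e" "y \<in> I e" "x \<noteq> v" "y \<noteq> v"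
  shows "\<phi> x = \<phi> y"
  using saturated(1)[of \<phi> "V - {v}" v] good_stuck[OF assms(1)] assms
  unfolding good_def by blast

lemma good_count:
  assumes "good \<phi> v"
  shows "card {e \<in> E. v \<in> I e \<and> (\<forall>x\<in>I e - {v}. \<phi> x = c)} = f c v"
proof -
  have "dg (insert v {w \<in> V - {v}. \<phi> w = c}) v = f c v"
    using saturated(2)[of \<phi> "V - {v}" v] good_stuck[OF assms(1)] assms
    unfolding good_def by blast
  moreover have "{e \<in> E. v \<in> I e \<and> I e \<subseteq> insert v {w \<in> V - {v}. \<phi> w = c}}
      = {e \<in> E. v \<in> I e \<and> (\<forall>x\<in>I e - {v}. \<phi> x = c)}"
    using inc_V by auto
  ultimately show ?thesis by (simp add: dg_def)
qed

text \<open>Only the class of \<open>\<phi> w\<close> changes: it loses \<open>w\<close> and gains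
  \<open>v\<close>. A set \<open>T\<close> in it that contains \<open>v\<close> misses
  \<open>w\<close>, hence misses at least one of the edges counted by \<open>f (\<phi> w) v\<close>,
  so \<open>v\<close> is the vertex of small degree in \<open>T\<close>.\<close>

lemma slide:
  assumes g: "good \<phi> v" and a: "adj v w"
  shows "good (\<phi>(v := \<phi> w)) w"
proof -
  have w: "w \<in> V" using a adj_in_V by auto
  have v: "v \<in> V" "proper \<phi> (V - {v})" using g by (auto simp: good_def)
  obtain e where e: "e \<in> E" "v \<in> I e" "w \<in> I e" and vw: "v \<noteq> w" using a by (auto simp: adj_def)
  let ?\<psi> = "\<phi>(v := \<phi> w)"
  have "degenerate c {x \<in> V - {w}. ?\<psi> x = c}" for c
  proof (cases "c = \<phi> w")
    case False
    then have "{x \<in> V - {w}. ?\<psi> x = c} = {x \<in> V - {v}. \<phi> x = c}" using vw v w by auto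
    then show ?thesis using v by (simp add: proper_def)
  next
    case c: True
    show ?thesis unfolding degenerate_def
    proof (intro allI impI)
      fix T assume T: "T \<subseteq> {x \<in> V - {w}. ?\<psi> x = c}" "T \<noteq> {}"
      show "\<exists>x\<in>T. dg T x < f c x"
      proof (cases "v \<in> T")
        case False
        then have "T \<subseteq> {x \<in> V - {v}. \<phi> x = c}" using T by (auto split: if_splits)
        moreover have "degenerate c {x \<in> V - {v}. \<phi> x = c}" using v by (simp add: proper_def)
        ultimately show ?thesis using T by (simp add: degenerate_def)
      next
        case True
        let ?A = "{e \<in> E. v \<in> I e \<and> (\<forall>x\<in>I e - {v}. \<phi> x = c)}"
        have "e \<in> ?A" using e good_edge_mono[OF g e(1,2) _ e(3)] vw c by blast
        moreover have "{e \<in> E. v \<in> I e \<and> I e \<subseteq> T} \<subseteq> ?A" using T by (auto split: if_splits)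
        moreover have "e \<notin> {e \<in> E. v \<in> I e \<and> I e \<subseteq> T}" using T e by auto
        ultimately have "{e \<in> E. v \<in> I e \<and> I e \<subseteq> T} \<subset> ?A" by blast
        then have "dg T v < card ?A"
          unfolding dg_def using finE by (intro psubset_card_mono) auto
        then show ?thesis using good_count[OF g] True by auto
      qed
    qed
  qed
  then show ?thesis using w by (simp add: good_def proper_def)
qed

lemma f_pos_adj:
  assumes "good \<phi> v" "adj v w" shows "f (\<phi> w) v > 0"
proof -
  obtain e where e: "e \<in> E" "v \<in> I e" "w \<in> I e" "v \<noteq> w" using assms by (auto simp: adj_def)
  have "e \<in> {e \<in> E. v \<in> I e \<and> (\<forall>x\<in>I e - {v}. \<phi> x = \<phi> w)}"
    using e good_edge_mono[OF assms(1) e(1,2) _ e(3)] by blast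
  then have "card {e \<in> E. v \<in> I e \<and> (\<forall>x\<in>I e - {v}. \<phi> x = \<phi> w)} > 0"
    using finE by (auto simp: card_gt_0_iff)
  then show ?thesis using good_count[OF assms(1)] by simp
qed

lemma f_pos_obtain:
  assumes "good \<phi> v" "f c v > 0"
  obtains w where "adj v w" "\<phi> w = c"
proof -
  have "{e \<in> E. v \<in> I e \<and> (\<forall>x\<in>I e - {v}. \<phi> x = c)} \<noteq> {}"
    using assms(2) good_count[OF assms(1), of c] by (metis card.empty less_irrefl)
  then obtain e where e: "e \<in> E" "v \<in> I e" "\<forall>x\<in>I e - {v}. \<phi> x = c" by auto
  obtain w where "w \<in> I e" "w \<noteq> v" using e(1) by (rule inc_other)
  then show ?thesis using that[of w] e by (auto simp: adj_def)
qed

text \<open>Confining the hole to the complement of \<open>Q\<close>, nonseparability lets it travel from outside \<open>Q\<close>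
  back to \<open>Q\<close> without using \<open>w\<close>; all colourings of the family \<open>\<Phi>\<close> evolve in parallel.\<close>

lemma travel:
  assumes "w \<in> V" "w \<in> Q" "Q \<subseteq> V" "Q \<noteq> {w}" "h \<in> V - Q"
    and start: "\<forall>\<phi>\<in>\<Phi>. good (\<lambda>x. if x \<in> Q then \<phi> x else \<psi> x) h"
  shows "\<exists>h' w' \<psi>'. h' \<in> V - Q \<and> w' \<in> Q - {w} \<and> adj h' w' \<and>
    (\<forall>\<phi>\<in>\<Phi>. good (\<lambda>x. if x \<in> Q then \<phi> x else \<psi>' x) h')"
proof -
  define R where "R = {h' \<in> V - Q. \<exists>\<psi>'. \<forall>\<phi>\<in>\<Phi>. good (\<lambda>x. if x \<in> Q then \<phi> x else \<psi>' x) h'}"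
  have "h \<in> R" using \<open>h \<in> V - Q\<close> start unfolding R_def by blast
  moreover have "R \<subseteq> V - {w}" using \<open>w \<in> Q\<close> by (auto simp: R_def)
  moreover have "R \<noteq> V - {w}"
  proof -
    obtain q where "q \<in> Q" "q \<noteq> w" using \<open>w \<in> Q\<close> \<open>Q \<noteq> {w}\<close> by blast
    moreover have "q \<notin> R" using \<open>q \<in> Q\<close> by (simp add: R_def)
    ultimately show ?thesis using \<open>Q \<subseteq> V\<close> by blast
  qed
  ultimately obtain e where e: "e \<in> E" "I e \<inter> R \<noteq> {}" "I e - R - {w} \<noteq> {}"
    using nonseparable[OF assms(1)] by blast
  then obtain h' w' where h': "h' \<in> I e" "h' \<in> R" and w': "w' \<in> I e" "w' \<notin> R" "w' \<noteq> w" by auto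
  have a: "adj h' w'" using e h' w' by (auto simp: adj_def)
  obtain \<psi>' where \<psi>': "\<And>\<phi>. \<phi> \<in> \<Phi> \<Longrightarrow> good (\<lambda>x. if x \<in> Q then \<phi> x else \<psi>' x) h'"
    and h'Q: "h' \<in> V - Q" using h' by (auto simp: R_def)
  have "w' \<in> Q"
  proof (rule ccontr)
    assume nQ: "w' \<notin> Q"
    \<comment> \<open>Both ends of this slide lie outside \<open>Q\<close>, so the new colour of
      \<open>h'\<close> reads only \<open>\<psi>'\<close> and is the same for every member of
      \<open>\<Phi>\<close>.\<close>
    have "good (\<lambda>x. if x \<in> Q then \<phi> x else (\<psi>'(h' := \<psi>' w')) x) w'" if "\<phi> \<in> \<Phi>" for \<phi>
    proof -
      have "(\<lambda>x. if x \<in> Q then \<phi> x else \<psi>' x)(h' := (\<lambda>x. if x \<in> Q then \<phi> x else \<psi>' x) w')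
        = (\<lambda>x. if x \<in> Q then \<phi> x else (\<psi>'(h' := \<psi>' w')) x)"
        using h'Q nQ by (auto simp: fun_eq_iff)
      then show ?thesis using slide[OF \<psi>'[OF that] a] by simp
    qed
    then have "w' \<in> R" using nQ a adj_in_V unfolding R_def by blast
    then show False using w' by simp
  qed
  then show ?thesis using h'Q a \<psi>' w' by blast
qed

text \<open>The first slide goes to a neighbour of colour \<open>c\<close> and leaves that colour on
  \<open>u\<close>. From then on the hole stays off \<open>u\<close>, and since \<open>u\<close>
  does not separate, it still reaches \<open>w\<close>.\<close>

lemma hole_anywhere:
  assumes "good \<phi> u" "f c u > 0" "w \<in> V" "w \<noteq> u"
  shows "\<exists>\<psi>. good \<psi> w \<and> \<psi> u = c"
proof (rule ccontr)
  assume no: "\<not> ?thesis"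
  obtain y where y: "adj u y" "\<phi> y = c" using f_pos_obtain assms by metis
  define R where "R = {h \<in> V - {u}. \<exists>\<psi>. good \<psi> h \<and> \<psi> u = c}"
  have "good (\<phi>(u := \<phi> y)) y" using slide assms(1) y by auto
  then have "y \<in> R" using y adj_in_V by (auto simp: R_def adj_def)
  moreover have "w \<notin> R" using no by (auto simp: R_def)
  ultimately obtain e where e: "e \<in> E" "I e \<inter> R \<noteq> {}" "I e - R - {u} \<noteq> {}"
    using nonseparable[OF good_in_V[OF assms(1)], of R] assms by (auto simp: R_def)
  then obtain h x where h: "h \<in> I e" "h \<in> R" and x: "x \<in> I e" "x \<notin> R" "x \<noteq> u" by auto
  have a: "adj h x" using e h x by (auto simp: adj_def)
  obtain \<psi> where \<psi>: "good \<psi> h" "\<psi> u = c" "h \<noteq> u" using h by (auto simp: R_def)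
  have "good (\<psi>(h := \<psi> x)) x" using slide \<psi> a by auto
  then have "x \<in> R" using x \<psi> a adj_in_V by (auto simp: R_def)
  then show False using x by simp
qed

lemma f_pos_step: "adj u w \<Longrightarrow> f c u > 0 \<Longrightarrow> f c w > 0"
proof -
  assume a: "adj u w" and pos: "f c u > 0"
  obtain \<phi> where "good \<phi> u" using good_exists adj_in_V a by blast
  then obtain \<psi> where "good \<psi> w" "\<psi> u = c"
    using hole_anywhere pos adj_in_V a by (metis adj_def)
  then show "f c w > 0" using f_pos_adj adj_sym a by metis
qed

lemma f_pos_const:
  assumes "u \<in> V" "f c u > 0" "w \<in> V" shows "f c w > 0"
proof (rule ccontr)
  assume "\<not> f c w > 0"
  then have "w \<notin> {v \<in> V. f c v > 0}" "u \<in> {v \<in> V. f c v > 0}" using assms by auto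
  then have "{v \<in> V. f c v > 0} \<noteq> {}" "{v \<in> V. f c v > 0} \<noteq> V" using assms by blast+
  then obtain e where e: "e \<in> E" "I e \<inter> {v \<in> V. f c v > 0} \<noteq> {}" "I e - {v \<in> V. f c v > 0} \<noteq> {}"
    using connected[of "{v \<in> V. f c v > 0}"] by blast
  obtain x where x: "x \<in> I e" "f c x > 0" using e by blast
  obtain y where y: "y \<in> I e" "\<not> f c y > 0" using e inc_V[OF e(1)] by blast
  have "adj x y" using e x y by (auto simp: adj_def)
  then show False using f_pos_step[OF _ x(2)] y by simp
qed

lemma monochromatic:
  assumes "v0 \<in> V" and one: "\<And>v c d. v \<in> V \<Longrightarrow> f c v > 0 \<Longrightarrow> f d v > 0 \<Longrightarrow> c = d"
  shows "\<exists>c. \<forall>v\<in>V. card {e \<in> E. v \<in> I e} \<le> f c v"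
proof (cases "\<exists>c. f c v0 > 0")
  case True
  then obtain c where c: "f c v0 > 0" by auto
  have "card {e \<in> E. v \<in> I e} \<le> f c v" if v: "v \<in> V" for v
  proof -
    have "f c v > 0" using f_pos_const assms(1) c v by blast
    then have "f d v = 0" if "d \<noteq> c" for d using one[OF v, of d c] that by blast
    then have "f d v = (if d = c then f c v else 0)" for d by simp
    then have "(\<Sum>d\<in>K. f d v) = (\<Sum>d\<in>K. if d = c then f c v else 0)" by (rule sum.cong[OF refl])
    also have "\<dots> \<le> f c v" using finK by simp
    finally show ?thesis using budget[OF v] by simp
  qed
  then show ?thesis by auto
next
  case False
  \<comment> \<open>All budgets vanish, hence so do all degrees, and any colour will do.\<close>
  then have "f d v = 0" if "v \<in> V" for v d
    using f_pos_const[OF that _ assms(1), of d] by auto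
  then have "card {e \<in> E. v \<in> I e} \<le> f c v" if "v \<in> V" for v c
    using budget[OF that] that by simp
  then show ?thesis by blast
qed

text \<open>Freeze \<open>e\<close>: after the hole has left \<open>v\<close> through an edge of another colour, it cannot
  return to \<open>e\<close>, since \<open>e\<close> then carries two colours besides the hole.\<close>

lemma edge_card_2:
  assumes "e \<in> E" "v \<in> I e" "f c v > 0" "f d v > 0" "c \<noteq> d"
  shows "card (I e) = 2"
proof (rule ccontr)
  assume "card (I e) \<noteq> 2"
  then have c3: "card (I e) \<ge> 3" using inc_card[OF assms(1)] by simp
  have vV: "v \<in> V" using assms inc_V by auto
  obtain \<phi> where \<phi>: "good \<phi> v" using good_exists vV by auto
  obtain x where x: "x \<in> I e" "x \<noteq> v" using inc_other assms(1) by metis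
  \<comment> \<open>One of \<open>c\<close> and \<open>d\<close> differs from the common colour of
    \<open>e\<close> off the hole. The hole leaves through a neighbour of that colour, which
    therefore lies outside \<open>e\<close>.\<close>
  obtain b where b: "f b v > 0" "b \<noteq> \<phi> x" using assms by metis
  obtain y where y: "adj v y" "\<phi> y = b" using f_pos_obtain \<phi> b by metis
  have col: "\<phi> z = \<phi> x" if "z \<in> I e" "z \<noteq> v" for z
    using good_edge_mono[OF \<phi> assms(1,2)] that x by blast
  have "y \<notin> I e" using y col[of y] b by (auto simp: adj_def)
  then have ye: "y \<in> V - I e" using adj_in_V y by blast
  let ?\<phi> = "\<phi>(v := b)"
  have "good ?\<phi> y" using slide[OF \<phi> y(1)] y by simp
  moreover have "(\<lambda>z. if z \<in> I e then ?\<phi> z else ?\<phi> z) = ?\<phi>" by (rule ext) (rule if_cancel)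
  ultimately have st: "\<forall>\<chi>\<in>{?\<phi>}. good (\<lambda>z. if z \<in> I e then \<chi> z else ?\<phi> z) y"
    by (simp only: ball_simps)
  have ne: "I e \<noteq> {v}" using x by auto
  obtain h' w' \<psi>' where h: "h' \<in> V - I e" "w' \<in> I e - {v}" "adj h' w'"
    and g: "\<forall>\<chi>\<in>{?\<phi>}. good (\<lambda>z. if z \<in> I e then \<chi> z else \<psi>' z) h'"
    using travel[OF vV assms(2) inc_V[OF assms(1)] ne ye st] by blast
  let ?\<chi> = "\<lambda>z. if z \<in> I e then ?\<phi> z else \<psi>' z"
  have "good ?\<chi> h'" by (rule bspec[OF g]) (rule singletonI)
  from slide[OF this h(3)] have g': "good (?\<chi>(h' := ?\<chi> w')) w'" .
  have "card {v, w'} \<le> 2" by (simp add: card_insert_if)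
  then have "\<not> I e \<subseteq> {v, w'}" using c3 card_mono[of "{v, w'}" "I e"] by auto
  then obtain z where z: "z \<in> I e" "z \<noteq> v" "z \<noteq> w'" by auto
  have "(?\<chi>(h' := ?\<chi> w')) z = (?\<chi>(h' := ?\<chi> w')) v"
    by (rule good_edge_mono[OF g' assms(1)]) (use h z assms in auto)
  moreover have "(?\<chi>(h' := ?\<chi> w')) z = \<phi> x" using z h col by auto
  moreover have "(?\<chi>(h' := ?\<chi> w')) v = b" using h assms(2) by auto
  ultimately show False using b by auto
qed

end

section \<open>Round trips in multigraphs: cliques and rings\<close>

locale multigraph_block = noncolorable_block +
  assumes edge_size: "e \<in> E \<Longrightarrow> card (I e) = 2"
begin

definition \<mu> :: "'a \<Rightarrow> 'a \<Rightarrow> nat" where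
  "\<mu> u v = card {e \<in> E. I e = {u, v}}"

lemma \<mu>_sym: "\<mu> u v = \<mu> v u"
  by (simp add: \<mu>_def insert_commute)

lemma edge_eq:
  assumes "e \<in> E" "u \<in> I e" "v \<in> I e" "u \<noteq> v" shows "I e = {u, v}"
proof -
  have "finite (I e)" using edge_size[OF assms(1)] card.infinite by fastforce
  then show ?thesis
    using card_subset_eq[of "I e" "{u, v}"] assms edge_size[OF assms(1)] by auto
qed

lemma adj_iff: "adj u v \<longleftrightarrow> u \<noteq> v \<and> \<mu> u v > 0"
proof
  assume "adj u v"
  then obtain e where "e \<in> E" "u \<in> I e" "v \<in> I e" "u \<noteq> v" by (auto simp: adj_def)
  then have "e \<in> {e \<in> E. I e = {u, v}}" using edge_eq by blast
  then show "u \<noteq> v \<and> \<mu> u v > 0"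
    using finE \<open>u \<noteq> v\<close> unfolding \<mu>_def by (auto simp: card_gt_0_iff)
next
  assume a: "u \<noteq> v \<and> \<mu> u v > 0"
  then have "{e \<in> E. I e = {u, v}} \<noteq> {}" unfolding \<mu>_def by (metis card.empty less_irrefl)
  then show "adj u v" using a by (auto simp: adj_def)
qed

lemma color_count:
  assumes "good \<phi> v"
  shows "(\<Sum>u\<in>V - {v}. if \<phi> u = c then \<mu> v u else 0) = f c v"
proof -
  let ?U = "{u \<in> V - {v}. \<phi> u = c}"
  have "{e \<in> E. v \<in> I e \<and> (\<forall>x\<in>I e - {v}. \<phi> x = c)} = (\<Union>u\<in>?U. {e \<in> E. I e = {v, u}})"
    (is "?L = ?R")
  proof
    show "?L \<subseteq> ?R"
    proof
      fix e assume e: "e \<in> ?L"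
      then have "e \<in> E" by simp
      then obtain u where u: "u \<in> I e" "u \<noteq> v" by (rule inc_other)
      then have "I e = {v, u}" using e edge_eq[of e v u] by auto
      moreover have "u \<in> ?U" using u e inc_V[OF \<open>e \<in> E\<close>] by auto
      ultimately show "e \<in> ?R" using \<open>e \<in> E\<close> by auto
    qed
  qed auto
  moreover have "card ?R = (\<Sum>u\<in>?U. card {e \<in> E. I e = {v, u}})"
    by (rule card_UN_disjoint) (use finV finE in \<open>auto simp: doubleton_eq_iff\<close>)
  ultimately have "(\<Sum>u\<in>?U. \<mu> v u) = f c v"
    using good_count[OF assms, of c] by (simp add: \<mu>_def)
  moreover have "(\<Sum>u\<in>?U. \<mu> v u) = (\<Sum>u\<in>V - {v}. if \<phi> u = c then \<mu> v u else 0)"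
    by (rule sum.inter_filter) (use finV in simp)
  ultimately show ?thesis by (simp only:)
qed

text \<open>Both colourings have the hole \<open>v\<close>, so by \<open>color_count\<close> both
  sums over \<open>V - {v}\<close> equal \<open>f c v\<close>; the parts outside \<open>D\<close>
  cancel, non-neighbours of \<open>v\<close> having weight zero.\<close>

lemma count_swap:
  assumes "good \<phi> v" "good \<psi> v" "D \<subseteq> V - {v}"
    and "\<And>u. u \<in> V - {v} - D \<Longrightarrow> \<phi> u = \<psi> u \<or> \<mu> v u = 0"
  shows "(\<Sum>u\<in>D. if \<phi> u = c then \<mu> v u else 0) = (\<Sum>u\<in>D. if \<psi> u = c then \<mu> v u else 0)"
proof -
  have split: "(\<Sum>u\<in>V - {v}. g u) = (\<Sum>u\<in>V - {v} - D. g u) + (\<Sum>u\<in>D. g u)" for g :: "'a \<Rightarrow> nat"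
    using assms(3) finV by (intro sum.subset_diff) auto
  have "(\<Sum>u\<in>V - {v} - D. if \<phi> u = c then \<mu> v u else 0)
      = (\<Sum>u\<in>V - {v} - D. if \<psi> u = c then \<mu> v u else 0)"
  proof (rule sum.cong[OF refl])
    fix u assume "u \<in> V - {v} - D"
    from assms(4)[OF this]
    show "(if \<phi> u = c then \<mu> v u else 0) = (if \<psi> u = c then \<mu> v u else 0)" by auto
  qed
  then show ?thesis
    using color_count[OF assms(1), of c] color_count[OF assms(2), of c] split by simp
qed

lemma slide_path:
  assumes "good \<phi> (x 0)" "inj_on x {..m}" "\<And>i. i < m \<Longrightarrow> adj (x i) (x (Suc i))" "j \<le> m"
  shows "\<exists>\<psi>. good \<psi> (x j) \<and> (\<forall>i<j. \<psi> (x i) = \<phi> (x (Suc i))) \<and> (\<forall>y. y \<notin> x ` {..<j} \<longrightarrow> \<psi> y = \<phi> y)"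
  using assms(4)
proof (induction j)
  case 0
  then show ?case using assms(1) by auto
next
  case (Suc j)
  then obtain \<psi> where \<psi>: "good \<psi> (x j)" "\<And>i. i < j \<Longrightarrow> \<psi> (x i) = \<phi> (x (Suc i))"
    "\<And>y. y \<notin> x ` {..<j} \<Longrightarrow> \<psi> y = \<phi> y" by auto
  have inj: "x a = x b \<longleftrightarrow> a = b" if "a \<le> m" "b \<le> m" for a b
    using assms(2) that by (auto simp: inj_on_def)
  have "x (Suc j) \<notin> x ` {..<j}" using inj Suc.prems by auto
  then have eq: "\<psi> (x (Suc j)) = \<phi> (x (Suc j))" using \<psi>(3) by blast
  have "good (\<psi>(x j := \<phi> (x (Suc j)))) (x (Suc j))"
    using slide[OF \<psi>(1) assms(3)[of j]] Suc.prems eq by simp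
  moreover have "(\<psi>(x j := \<phi> (x (Suc j)))) (x i) = \<phi> (x (Suc i))" if "i < Suc j" for i
    using that \<psi>(2)[of i] inj[of i j] Suc.prems by (cases "i = j") auto
  moreover have "(\<psi>(x j := \<phi> (x (Suc j)))) y = \<phi> y" if "y \<notin> x ` {..<Suc j}" for y
    using that \<psi>(3)[of y] by (auto simp: lessThan_Suc)
  ultimately show ?case by blast
qed

text \<open>The first slide parks the colour of \<open>x 1\<close> on \<open>x 0\<close>, and the
  closing slide moves it on to \<open>x m\<close>. The colours on the cycle without
  \<open>x 0\<close> are thus shifted cyclically by one.\<close>

lemma rotate:
  assumes "good \<phi> (x 0)" "inj_on x {..m}" "\<And>i. i < m \<Longrightarrow> adj (x i) (x (Suc i))"
    "adj (x m) (x 0)" "2 \<le> m"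
  shows "\<exists>\<psi>. good \<psi> (x 0) \<and> (\<forall>i. 0 < i \<and> i < m \<longrightarrow> \<psi> (x i) = \<phi> (x (Suc i))) \<and>
    \<psi> (x m) = \<phi> (x 1) \<and> (\<forall>y. y \<notin> x ` {..m} \<longrightarrow> \<psi> y = \<phi> y)"
proof -
  obtain \<psi> where \<psi>: "good \<psi> (x m)" "\<And>i. i < m \<Longrightarrow> \<psi> (x i) = \<phi> (x (Suc i))"
    "\<And>y. y \<notin> x ` {..<m} \<Longrightarrow> \<psi> y = \<phi> y" using slide_path[OF assms(1-3) order.refl] by auto
  have inj: "x a = x b \<longleftrightarrow> a = b" if "a \<le> m" "b \<le> m" for a b
    using assms(2) that by (auto simp: inj_on_def)
  have "good (\<psi>(x m := \<phi> (x 1))) (x 0)"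
    using slide[OF \<psi>(1) assms(4)] \<psi>(2)[of 0] assms(5) by simp
  moreover have "(\<psi>(x m := \<phi> (x 1))) (x i) = \<phi> (x (Suc i))" if "0 < i" "i < m" for i
    using that \<psi>(2)[of i] inj[of i m] by auto
  moreover have "(\<psi>(x m := \<phi> (x 1))) y = \<phi> y" if "y \<notin> x ` {..m}" for y
  proof -
    have "y \<noteq> x m" "y \<notin> x ` {..<m}" using that by auto
    then show ?thesis using \<psi>(3)[of y] by simp
  qed
  ultimately show ?thesis by (intro exI[of _ "\<psi>(x m := \<phi> (x 1))"]) simp
qed

text \<open>By \<open>chord\<close>, the hole has only \<open>x 1\<close> and \<open>x m\<close> as
  neighbours on the cycle, so a rotation affects the counts at \<open>x 0\<close> only there: the
  colours \<open>\<phi> (x 1)\<close>, \<open>\<phi> (x m)\<close> become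
  \<open>\<phi> (x 2)\<close>, \<open>\<phi> (x 1)\<close>. Equality of the weights in colour
  \<open>\<phi> (x m)\<close> gives both claims.\<close>

lemma rotation_colors:
  assumes "good \<phi> (x 0)" "inj_on x {..m}" "\<And>i. i < m \<Longrightarrow> adj (x i) (x (Suc i))"
    "adj (x m) (x 0)" "2 \<le> m" and chord: "\<And>i. 1 < i \<Longrightarrow> i < m \<Longrightarrow> \<not> adj (x 0) (x i)"
  shows "\<phi> (x 2) = \<phi> (x m)"
    and "\<phi> (x 1) \<noteq> \<phi> (x m) \<Longrightarrow> \<mu> (x 0) (x 1) = \<mu> (x 0) (x m)"
proof -
  obtain \<psi> where \<psi>: "good \<psi> (x 0)" "\<And>i. 0 < i \<Longrightarrow> i < m \<Longrightarrow> \<psi> (x i) = \<phi> (x (Suc i))"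
    "\<psi> (x m) = \<phi> (x 1)" "\<And>y. y \<notin> x ` {..m} \<Longrightarrow> \<psi> y = \<phi> y"
    using rotate[OF assms(1-5)] by auto
  have inj: "x a = x b \<longleftrightarrow> a = b" if "a \<le> m" "b \<le> m" for a b
    using assms(2) that by (auto simp: inj_on_def)
  have a1: "adj (x 0) (x 1)" using assms(3)[of 0] assms(5) by simp
  have am: "adj (x 0) (x m)" using assms(4) adj_sym by blast
  have ne: "x 1 \<noteq> x m" using inj[of 1 m] assms(5) by simp
  have D: "{x 1, x m} \<subseteq> V - {x 0}"
    using a1 am adj_in_V by (auto simp: adj_def)
  have off: "\<phi> u = \<psi> u \<or> \<mu> (x 0) u = 0" if "u \<in> V - {x 0} - {x 1, x m}" for u
  proof (cases "u \<in> x ` {..m}")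
    case True
    then obtain i where i: "i \<le> m" "u = x i" by auto
    then have "x i \<noteq> x 0" "x i \<noteq> x 1" "x i \<noteq> x m" using that by auto
    then have "i \<noteq> 0" "i \<noteq> 1" "i \<noteq> m" by metis+
    then have "\<not> adj (x 0) u" using chord[of i] i by simp
    then show ?thesis using adj_iff that by auto
  next
    case False
    then show ?thesis using \<psi>(4) by simp
  qed
  have eq: "(\<Sum>u\<in>{x 1, x m}. if \<phi> u = c then \<mu> (x 0) u else 0) =
     (\<Sum>u\<in>{x 1, x m}. if \<psi> u = c then \<mu> (x 0) u else 0)" for c
    by (rule count_swap[OF assms(1) \<psi>(1) D off])
  have \<psi>1: "\<psi> (x 1) = \<phi> (x 2)"
    using \<psi>(2)[of 1] assms(5) by (simp add: numeral_2_eq_2)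
  have *: "(if \<phi> (x 1) = c then \<mu> (x 0) (x 1) else 0) + (if \<phi> (x m) = c then \<mu> (x 0) (x m) else 0)
     = (if \<phi> (x 2) = c then \<mu> (x 0) (x 1) else 0) + (if \<phi> (x 1) = c then \<mu> (x 0) (x m) else 0)" for c
    using eq[of c] ne \<psi>1 \<psi>(3) by (simp split del: if_split del: One_nat_def)
  have pos: "\<mu> (x 0) (x 1) > 0" "\<mu> (x 0) (x m) > 0" using a1 am by (simp_all add: adj_iff)
  have same: "\<phi> (x 2) = \<phi> (x m)" if "\<phi> (x 1) = \<phi> (x m)"
    by (rule ccontr) (use *[of "\<phi> (x m)"] that pos in simp)
  have diff: "\<phi> (x 2) = \<phi> (x m) \<and> \<mu> (x 0) (x 1) = \<mu> (x 0) (x m)" if "\<phi> (x 1) \<noteq> \<phi> (x m)"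
    by (cases "\<phi> (x 2) = \<phi> (x m)") (use *[of "\<phi> (x m)"] that pos in simp_all)
  show "\<phi> (x 2) = \<phi> (x m)" using same diff by blast
  show "\<phi> (x 1) \<noteq> \<phi> (x m) \<Longrightarrow> \<mu> (x 0) (x 1) = \<mu> (x 0) (x m)" using diff by blast
qed

section \<open>Triangles with two colours and maximal cliques\<close>

lemma triangle_swap:
  assumes "good \<phi> v" "adj v a" "adj a b" "adj b v"
  shows "\<exists>\<psi>. good \<psi> v \<and> \<psi> a = \<phi> b \<and> \<psi> b = \<phi> a \<and> (\<forall>y. y \<notin> {v, a, b} \<longrightarrow> \<psi> y = \<phi> y)"
proof -
  have ne: "v \<noteq> a" "a \<noteq> b" "b \<noteq> v" using assms by (auto simp: adj_def)
  have "good (\<phi>(v := \<phi> a)) a" using slide assms by blast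
  from slide[OF this assms(3)] have "good (\<phi>(v := \<phi> a, a := \<phi> b)) b" using ne by simp
  from slide[OF this assms(4)] have "good (\<phi>(v := \<phi> a, a := \<phi> b, b := \<phi> a)) v" using ne by simp
  then show ?thesis using ne by (intro exI[of _ "\<phi>(v := \<phi> a, a := \<phi> b, b := \<phi> a)"]) auto
qed

text \<open>Sending the hole around the triangle swaps the colours of \<open>a\<close> and
  \<open>b\<close>, so the count of colour \<open>\<phi> a\<close> at \<open>v\<close> equates
  \<open>\<mu> v a\<close> and \<open>\<mu> v b\<close>. After a slide to \<open>a\<close> the
  colours of \<open>v\<close> and \<open>b\<close> differ again, and the same comparison there gives
  the third multiplicity.\<close>

lemma triangle_mult:
  assumes "good \<phi> v" "adj v a" "adj a b" "adj b v" "\<phi> a \<noteq> \<phi> b"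
  shows "\<mu> v a = \<mu> v b" "\<mu> a b = \<mu> v a"
proof -
  have *: "\<mu> v a = \<mu> v b"
    if t: "good \<phi> v" "adj v a" "adj a b" "adj b v" "\<phi> a \<noteq> \<phi> b" for \<phi> v a b
  proof -
    obtain \<psi> where \<psi>: "good \<psi> v" "\<psi> a = \<phi> b" "\<psi> b = \<phi> a"
      "\<And>y. y \<notin> {v, a, b} \<Longrightarrow> \<psi> y = \<phi> y" using triangle_swap[OF t(1-4)] by auto
    have D: "{a, b} \<subseteq> V - {v}" "a \<noteq> b" using t adj_in_V by (auto simp: adj_def)
    have "\<phi> u = \<psi> u \<or> \<mu> v u = 0" if "u \<in> V - {v} - {a, b}" for u using \<psi>(4)[of u] that by auto
    from count_swap[OF t(1) \<psi>(1) D(1) this, of "\<phi> a"] show ?thesis using D(2) \<psi> t(5) by auto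
  qed
  show "\<mu> v a = \<mu> v b" using *[OF assms] .
  have ne: "v \<noteq> a" "a \<noteq> b" "b \<noteq> v" using assms by (auto simp: adj_def)
  have "\<mu> a v = \<mu> a b"
    by (rule *[of "\<phi>(v := \<phi> a)"]) (use assms(5) ne slide[OF assms(1,2)]
      assms(2-4)[THEN adj_sym] in simp_all)
  then show "\<mu> a b = \<mu> v a" using \<mu>_sym by metis
qed

text \<open>Otherwise \<open>q, a, z, b\<close> is a four-cycle without a chord at \<open>q\<close>
  (the chord from \<open>a\<close> to \<open>b\<close> is harmless), and
  \<open>rotation_colors\<close> gives \<open>z\<close> the colour of \<open>b\<close> in every
  colouring with hole \<open>q\<close>. Swapping the colours of \<open>a\<close> and
  \<open>b\<close> keeps that of \<open>z\<close>, a contradiction.\<close>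

lemma diamond:
  assumes "good \<phi> q" "adj q a" "adj a b" "adj b q" "\<phi> a \<noteq> \<phi> b" "adj z a" "adj z b" "z \<noteq> q"
  shows "adj z q"
proof (rule ccontr)
  assume no: "\<not> adj z q"
  have *: "\<psi> z = \<psi> b" if g: "good \<psi> q" for \<psi>
  proof -
    let ?x = "\<lambda>i. [q, a, z, b] ! i"
    have ne: "q \<noteq> a" "a \<noteq> b" "b \<noteq> q" "z \<noteq> a" "z \<noteq> b" using assms by (auto simp: adj_def)
    have "\<psi> (?x 2) = \<psi> (?x 3)"
    proof (rule rotation_colors(1))
      show "good \<psi> (?x 0)" using g by simp
      show "inj_on ?x {..3}"
        using ne assms(8) by (auto simp: inj_on_def numeral_3_eq_3 le_Suc_eq nth_Cons split: nat.splits)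
      show "adj (?x i) (?x (Suc i))" if "i < 3" for i
      proof -
        have "i = 0 \<or> i = 1 \<or> i = 2" using that by auto
        then show ?thesis using assms(2,6,7) adj_sym[OF assms(6)] by (auto simp: numeral_2_eq_2)
      qed
      show "adj (?x 3) (?x 0)" using assms by simp
      show "\<not> adj (?x 0) (?x i)" if "1 < i" "i < 3" for i
      proof -
        have "i = 2" using that by auto
        then show ?thesis using no adj_sym[of q z] by auto
      qed
    qed simp
    then show ?thesis by simp
  qed
  obtain \<psi> where \<psi>: "good \<psi> q" "\<psi> a = \<phi> b" "\<psi> b = \<phi> a"
      "\<And>y. y \<notin> {q, a, b} \<Longrightarrow> \<psi> y = \<phi> y" using triangle_swap[OF assms(1-4)] by auto
  have "z \<notin> {q, a, b}" using assms by (auto simp: adj_def)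
  then show False using *[OF assms(1)] *[OF \<psi>(1)] \<psi> assms(5) by auto
qed

text \<open>The last conjunct asks for two colours beside the hole: only then can a swap be visible
  in a colour count. It also forces at least three vertices.\<close>

definition colored_clique :: "'a set \<Rightarrow> nat \<Rightarrow> ('a \<Rightarrow> 'c) \<Rightarrow> 'a \<Rightarrow> bool" where
  "colored_clique Q t \<phi> w \<longleftrightarrow> Q \<subseteq> V \<and> 0 < t \<and> (\<forall>u\<in>Q. \<forall>v\<in>Q. u \<noteq> v \<longrightarrow> \<mu> u v = t) \<and>
     w \<in> Q \<and> good \<phi> w \<and> (\<exists>a\<in>Q - {w}. \<exists>b\<in>Q - {w}. \<phi> a \<noteq> \<phi> b)"

lemma colored_clique_adj:
  "colored_clique Q t \<phi> w \<Longrightarrow> u \<in> Q \<Longrightarrow> v \<in> Q \<Longrightarrow> u \<noteq> v \<Longrightarrow> adj u v"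
  by (auto simp: colored_clique_def adj_iff)

text \<open>One slide inside the clique suffices: \<open>w\<close> takes over the colour of
  \<open>w'\<close>, so the same colours occur off the hole as before.\<close>

lemma colored_clique_move:
  assumes "colored_clique Q t \<phi> w" "w' \<in> Q"
  shows "\<exists>\<psi>. colored_clique Q t \<psi> w'"
proof (cases "w' = w")
  case True
  then show ?thesis using assms by auto
next
  case False
  have "adj w w'" using colored_clique_adj assms False by (metis colored_clique_def)
  then have g: "good (\<phi>(w := \<phi> w')) w'" using slide assms by (auto simp: colored_clique_def)
  obtain a b where ab: "a \<in> Q - {w}" "b \<in> Q - {w}" "\<phi> a \<noteq> \<phi> b"
    using assms by (auto simp: colored_clique_def)
  have w: "w \<in> Q" using assms by (auto simp: colored_clique_def)
  define a' b' where "a' = (if a = w' then w else a)" and "b' = (if b = w' then w else b)"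
  have "a' \<in> Q - {w'}" "b' \<in> Q - {w'}" "(\<phi>(w := \<phi> w')) a' \<noteq> (\<phi>(w := \<phi> w')) b'"
    using ab w False by (auto simp: a'_def b'_def)
  then have "colored_clique Q t (\<phi>(w := \<phi> w')) w'"
    using assms g unfolding colored_clique_def by blast
  then show ?thesis by blast
qed

lemma colored_clique_swap:
  assumes "colored_clique Q t \<phi> w" "a \<in> Q - {w}" "b \<in> Q - {w}" "a \<noteq> b"
  shows "\<exists>\<psi>. good \<psi> w \<and> \<psi> a = \<phi> b \<and> \<psi> b = \<phi> a \<and> (\<forall>y. y \<notin> {w, a, b} \<longrightarrow> \<psi> y = \<phi> y)"
proof (rule triangle_swap)
  have "w \<in> Q" using assms by (auto simp: colored_clique_def)
  then show "adj w a" "adj a b" "adj b w" using assms colored_clique_adj[OF assms(1)] by auto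
qed (use assms in \<open>auto simp: colored_clique_def\<close>)

text \<open>If \<open>a\<close> and \<open>b\<close> agree once the hole is at \<open>q\<close>,
  some third vertex \<open>d\<close> has another colour, and swapping \<open>b\<close> with
  \<open>d\<close> separates them.\<close>

lemma colored_clique_distinguish:
  assumes "colored_clique Q t \<phi> w" "q \<in> Q" "a \<in> Q - {q}" "b \<in> Q - {q}" "a \<noteq> b"
  shows "\<exists>\<psi>. good \<psi> q \<and> \<psi> a \<noteq> \<psi> b"
proof -
  obtain \<psi> where \<psi>: "colored_clique Q t \<psi> q" using colored_clique_move assms by blast
  show ?thesis
  proof (cases "\<psi> a = \<psi> b")
    case False
    then show ?thesis using \<psi> by (auto simp: colored_clique_def)
  next
    case True
    have "\<exists>d\<in>Q - {q}. \<psi> d \<noteq> \<psi> b" using \<psi> unfolding colored_clique_def by metis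
    then obtain d where d: "d \<in> Q - {q}" "\<psi> d \<noteq> \<psi> b" by blast
    then have "d \<noteq> a" "d \<noteq> b" using True by auto
    then obtain \<chi> where "good \<chi> q" "\<chi> b = \<psi> d" "\<And>y. y \<notin> {q, b, d} \<Longrightarrow> \<chi> y = \<psi> y"
      using colored_clique_swap[OF \<psi> assms(4) d(1)] \<open>d \<noteq> b\<close> by auto
    moreover have "a \<notin> {q, b, d}" using assms \<open>d \<noteq> a\<close> by auto
    ultimately show ?thesis using d True by metis
  qed
qed

text \<open>For adjacency to \<open>q\<close>, a colouring with hole \<open>q\<close> that tells
  \<open>a\<close> and \<open>b\<close> apart makes \<open>diamond\<close> applicable. For the
  multiplicity, some \<open>d\<close> in \<open>Q\<close> is coloured differently from
  \<open>z\<close>, and \<open>triangle_mult\<close> equates \<open>\<mu> q z\<close> with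
  \<open>\<mu> q d\<close>.\<close>

lemma colored_clique_extend:
  assumes Q: "colored_clique Q t \<phi> w" and z: "z \<notin> Q" "a \<in> Q" "b \<in> Q" "a \<noteq> b" "adj z a" "adj z b"
  shows "colored_clique (insert z Q) t \<phi> w"
proof -
  have adjQ: "adj u v" if "u \<in> Q" "v \<in> Q" "u \<noteq> v" for u v
    using colored_clique_adj[OF Q that] .
  have zq: "adj z q" if q: "q \<in> Q" for q
  proof (cases "q = a \<or> q = b")
    case False
    obtain \<psi> where "good \<psi> q" "\<psi> a \<noteq> \<psi> b"
      using colored_clique_distinguish[OF Q q] z False by blast
    then show ?thesis using diamond[of \<psi> q a b z] adjQ False q z by auto
  qed (use z in auto)
  have mult: "\<mu> z q = t" if q: "q \<in> Q" for q
  proof -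
    obtain \<psi> where \<psi>: "colored_clique Q t \<psi> q" using colored_clique_move Q q by blast
    then have "\<exists>d\<in>Q - {q}. \<psi> d \<noteq> \<psi> z" unfolding colored_clique_def by metis
    then obtain d where d: "d \<in> Q - {q}" "\<psi> d \<noteq> \<psi> z" by blast
    have "\<mu> q d = \<mu> q z"
    proof (rule triangle_mult(1)[of \<psi>])
      show "good \<psi> q" using \<psi> by (simp add: colored_clique_def)
      show "adj q d" "adj z q" using adjQ[of q d] zq d q by auto
      show "adj d z" using zq[of d] d adj_sym by blast
    qed (use d in simp)
    moreover have "\<mu> q d = t" using Q d q by (auto simp: colored_clique_def)
    ultimately show ?thesis using \<mu>_sym by metis
  qed
  have "z \<in> V" using z adj_in_V by auto
  moreover have "\<mu> u v = t" if "u \<in> insert z Q" "v \<in> insert z Q" "u \<noteq> v" for u v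
    using that mult \<mu>_sym[of u v] Q by (auto simp: colored_clique_def)
  ultimately show ?thesis using Q unfolding colored_clique_def by blast
qed

text \<open>An ear from \<open>w\<close> to \<open>w'\<close> outside a maximal \<open>Q\<close>: sending the hole once around recolours \<open>w'\<close> by the
  colour of the first ear vertex, independently of the colours inside \<open>Q\<close>. Doing this before and after
  swapping the colours of \<open>w'\<close> and \<open>q\<close> changes a colour count at \<open>w\<close>.\<close>

lemma maximal_colored_clique:
  assumes Q: "colored_clique Q t \<chi> w0"
    and max: "\<And>z t \<phi> w. z \<notin> Q \<Longrightarrow> \<not> colored_clique (insert z Q) t \<phi> w"
  shows "Q = V"
proof (rule ccontr)
  assume "Q \<noteq> V"
  have QV: "Q \<subseteq> V" using Q by (simp add: colored_clique_def)
  moreover have "Q \<noteq> {}" using Q by (auto simp: colored_clique_def)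
  ultimately obtain e where e: "e \<in> E" "I e \<inter> Q \<noteq> {}" "I e - Q \<noteq> {}"
    using connected \<open>Q \<noteq> V\<close> by blast
  obtain w z where w: "w \<in> I e" "w \<in> Q" and z: "z \<in> I e" "z \<notin> Q"
    using e by blast
  have wz: "adj w z" using e w z by (auto simp: adj_def)
  have zV: "z \<in> V" using wz adj_in_V by blast
  have wV: "w \<in> V" using wz adj_in_V by blast
  obtain \<phi> where \<phi>: "colored_clique Q t \<phi> w" using colored_clique_move[OF Q w(2)] by blast
  have ne: "Q \<noteq> {w}" using \<phi> by (auto simp: colored_clique_def)
  \<comment> \<open>All colourings with hole \<open>w\<close> that agree with \<open>\<phi>\<close>
    outside \<open>Q\<close>, after the first slide to \<open>z\<close>. Sending the whole family
    through \<open>travel\<close> yields ear colours \<open>\<psi>'\<close> common to all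
    members.\<close>
  define \<Phi> where "\<Phi> = {\<chi>. \<exists>\<phi>'. good \<phi>' w \<and> (\<forall>y. y \<notin> Q \<longrightarrow> \<phi>' y = \<phi> y) \<and> \<chi> = \<phi>'(w := \<phi> z)}"
  have start: "\<forall>\<chi>\<in>\<Phi>. good (\<lambda>x. if x \<in> Q then \<chi> x else \<phi> x) z"
  proof
    fix \<chi> assume "\<chi> \<in> \<Phi>"
    then obtain \<phi>' where \<phi>': "good \<phi>' w" "\<And>y. y \<notin> Q \<Longrightarrow> \<phi>' y = \<phi> y" "\<chi> = \<phi>'(w := \<phi> z)"
      by (auto simp: \<Phi>_def)
    then have "good \<chi> z" using slide[OF \<phi>'(1) wz] \<phi>'(2)[OF z(2)] by simp
    moreover have "(\<lambda>x. if x \<in> Q then \<chi> x else \<phi> x) = \<chi>"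
      using \<phi>'(2,3) w by (auto simp: fun_eq_iff)
    ultimately show "good (\<lambda>x. if x \<in> Q then \<chi> x else \<phi> x) z" by simp
  qed
  obtain h' w' \<psi>' where h': "h' \<in> V - Q" and w': "w' \<in> Q - {w}" and hw: "adj h' w'"
    and g: "\<And>\<chi>. \<chi> \<in> \<Phi> \<Longrightarrow> good (\<lambda>x. if x \<in> Q then \<chi> x else \<psi>' x) h'"
    using travel[OF wV w(2) QV ne _ start] zV z by blast
  \<comment> \<open>Otherwise \<open>h'\<close> would have the two neighbours \<open>w\<close> and
    \<open>w'\<close> in \<open>Q\<close> and could be added. This matters because \<open>h'\<close>
    ends up with the colour \<open>\<phi>' w'\<close>, the only ear colour depending on
    \<open>\<phi>'\<close>, which is now invisible in counts at \<open>w\<close>.\<close>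
  have "\<not> adj h' w"
    using colored_clique_extend[OF \<phi>, of h' w w'] max h' w' w hw by auto
  then have h'0: "\<mu> w h' = 0" using adj_iff \<mu>_sym h' w by auto
  have ww': "adj w' w" using colored_clique_adj[OF \<phi>] w w' by auto
  have return: "\<exists>\<eta>. good \<eta> w \<and> \<eta> w' = \<phi> z \<and> (\<forall>x\<in>Q - {w, w'}. \<eta> x = \<phi>' x) \<and>
      (\<forall>x. x \<notin> Q \<longrightarrow> x \<noteq> h' \<longrightarrow> \<eta> x = \<psi>' x)"
    if "good \<phi>' w" "\<forall>y. y \<notin> Q \<longrightarrow> \<phi>' y = \<phi> y" for \<phi>'
  proof -
    have "\<phi>'(w := \<phi> z) \<in> \<Phi>" using that by (auto simp: \<Phi>_def)
    from slide[OF g[OF this] hw]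
    have "good ((\<lambda>x. if x \<in> Q then (\<phi>'(w := \<phi> z)) x else \<psi>' x)(h' := \<phi>' w')) w'"
      using w' by simp
    from slide[OF this ww']
    have "good ((\<lambda>x. if x \<in> Q then (\<phi>'(w := \<phi> z)) x else \<psi>' x)(h' := \<phi>' w', w' := \<phi> z)) w"
      using w h' by (auto split: if_splits)
    then show ?thesis using w' h'
      by (intro exI[of _ "(\<lambda>x. if x \<in> Q then (\<phi>'(w := \<phi> z)) x else \<psi>' x)(h' := \<phi>' w', w' := \<phi> z)"]) auto
  qed
  have "\<exists>q\<in>Q - {w}. \<phi> q \<noteq> \<phi> w'" using \<phi> unfolding colored_clique_def by metis
  then obtain q where q: "q \<in> Q - {w}" "\<phi> q \<noteq> \<phi> w'" by blast
  then have qw': "q \<noteq> w'" by auto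
  obtain \<phi>2 where \<phi>2: "good \<phi>2 w" "\<phi>2 q = \<phi> w'" "\<And>y. y \<notin> {w, q, w'} \<Longrightarrow> \<phi>2 y = \<phi> y"
    using colored_clique_swap[OF \<phi> q(1) w' qw'] by auto
  have "good \<phi> w" "\<forall>y. y \<notin> Q \<longrightarrow> \<phi> y = \<phi> y"
    using \<phi> by (simp_all add: colored_clique_def)
  from return[OF this] obtain \<eta>1 where "good \<eta>1 w \<and> \<eta>1 w' = \<phi> z \<and>
    (\<forall>x\<in>Q - {w, w'}. \<eta>1 x = \<phi> x) \<and> (\<forall>x. x \<notin> Q \<longrightarrow> x \<noteq> h' \<longrightarrow> \<eta>1 x = \<psi>' x)" ..
  then have \<eta>1: "good \<eta>1 w" "\<eta>1 w' = \<phi> z" "\<And>x. x \<in> Q - {w, w'} \<Longrightarrow> \<eta>1 x = \<phi> x"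
    "\<And>x. x \<notin> Q \<Longrightarrow> x \<noteq> h' \<Longrightarrow> \<eta>1 x = \<psi>' x" by simp_all
  have "\<phi>2 y = \<phi> y" if "y \<notin> Q" for y using \<phi>2(3)[of y] that w q w' by auto
  then have "\<forall>y. y \<notin> Q \<longrightarrow> \<phi>2 y = \<phi> y" by simp
  from return[OF \<phi>2(1) this] obtain \<eta>2 where "good \<eta>2 w \<and> \<eta>2 w' = \<phi> z \<and>
    (\<forall>x\<in>Q - {w, w'}. \<eta>2 x = \<phi>2 x) \<and> (\<forall>x. x \<notin> Q \<longrightarrow> x \<noteq> h' \<longrightarrow> \<eta>2 x = \<psi>' x)" ..
  then have \<eta>2: "good \<eta>2 w" "\<eta>2 w' = \<phi> z" "\<And>x. x \<in> Q - {w, w'} \<Longrightarrow> \<eta>2 x = \<phi>2 x"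
    "\<And>x. x \<notin> Q \<Longrightarrow> x \<noteq> h' \<Longrightarrow> \<eta>2 x = \<psi>' x" by simp_all
  \<comment> \<open>Both colourings now carry \<open>\<phi> z\<close> on \<open>w'\<close>, so of
    the swap of \<open>q\<close> and \<open>w'\<close> only the change at \<open>q\<close> survives;
    the count at \<open>w\<close> detects this imbalance.\<close>
  have "\<eta>1 u = \<eta>2 u \<or> \<mu> w u = 0" if u: "u \<in> V - {w} - {q}" for u
  proof -
    consider "u = h'" | "u = w'" | "u \<in> Q - {w, w', q}" | "u \<notin> Q" "u \<noteq> h'" using u by blast
    then show ?thesis
    proof cases
      case 3
      then have "\<eta>1 u = \<phi> u" "\<eta>2 u = \<phi>2 u" "\<phi>2 u = \<phi> u"
        using \<eta>1(3)[of u] \<eta>2(3)[of u] \<phi>2(3)[of u] by auto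
      then show ?thesis by simp
    next
      case 4
      then show ?thesis using \<eta>1(4)[of u] \<eta>2(4)[of u] by simp
    qed (simp_all add: h'0 \<eta>1(2) \<eta>2(2))
  qed
  moreover have "{q} \<subseteq> V - {w}" using q QV by auto
  ultimately have "(\<Sum>u\<in>{q}. if \<eta>1 u = \<phi> q then \<mu> w u else 0) = (\<Sum>u\<in>{q}. if \<eta>2 u = \<phi> q then \<mu> w u else 0)"
    using count_swap[OF \<eta>1(1) \<eta>2(1)] by blast
  moreover have "\<eta>1 q = \<phi> q" "\<eta>2 q = \<phi> w'" using \<eta>1(3)[of q] \<eta>2(3)[of q] q qw' \<phi>2 by auto
  ultimately have "\<mu> w q = 0" using q(2) by auto
  moreover have "\<mu> w q = t" using \<phi> q w by (auto simp: colored_clique_def)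
  moreover have "0 < t" using \<phi> by (simp add: colored_clique_def)
  ultimately show False by simp
qed

text \<open>By \<open>triangle_mult\<close> the triangle is a coloured clique; one of largest
  cardinality, whatever its multiplicity and colouring, fills \<open>V\<close>.\<close>

lemma complete_if_triangle:
  assumes "good \<phi> v" "adj v a" "adj a b" "adj b v" "\<phi> a \<noteq> \<phi> b"
  shows "\<exists>t>0. \<forall>x\<in>V. \<forall>y\<in>V. x \<noteq> y \<longrightarrow> \<mu> x y = t"
proof -
  let ?P = "\<lambda>Q. \<exists>t \<phi> w. colored_clique Q t \<phi> w"
  have m: "\<mu> v a = \<mu> v b" "\<mu> a b = \<mu> v a" using triangle_mult[OF assms] by auto
  have "colored_clique {v, a, b} (\<mu> v a) \<phi> v"
    unfolding colored_clique_def
  proof (intro conjI ballI impI)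
    show "{v, a, b} \<subseteq> V" using assms adj_in_V by auto
    show "0 < \<mu> v a" using assms adj_iff by auto
    show "\<mu> x y = \<mu> v a" if "x \<in> {v, a, b}" "y \<in> {v, a, b}" "x \<noteq> y" for x y
      using that m \<mu>_sym[of a v] \<mu>_sym[of b v] \<mu>_sym[of b a] by auto
    show "\<exists>a'\<in>{v, a, b} - {v}. \<exists>b'\<in>{v, a, b} - {v}. \<phi> a' \<noteq> \<phi> b'"
      using assms by (intro bexI[of _ a] bexI[of _ b]) (auto simp: adj_def)
  qed (use assms in auto)
  then have "?P {v, a, b}" by blast
  moreover have "\<forall>Q. ?P Q \<longrightarrow> card Q < Suc (card V)"
    using finV by (auto simp: colored_clique_def less_Suc_eq_le intro: card_mono)
  ultimately obtain Q where Q: "?P Q" "\<And>Q'. ?P Q' \<Longrightarrow> card Q' \<le> card Q"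
    using ex_has_greatest_nat[of ?P "{v, a, b}" card "Suc (card V)"] by blast
  obtain t \<phi>' w where t: "colored_clique Q t \<phi>' w" using Q by blast
  have "finite Q" using t finV by (auto simp: colored_clique_def intro: finite_subset)
  have "Q = V"
  proof (rule maximal_colored_clique[OF t])
    fix z t \<phi> w assume "z \<notin> Q"
    then have "card (insert z Q) = Suc (card Q)" using \<open>finite Q\<close> by simp
    then have "\<not> ?P (insert z Q)" using Q(2)[of "insert z Q"] by auto
    then show "\<not> colored_clique (insert z Q) t \<phi> w" by blast
  qed
  then show ?thesis using t unfolding colored_clique_def by blast
qed

end

section \<open>Induced cycles through the hole\<close>

lemma dvd_int_iff:
  fixes n k :: int
  assumes "- n \<le> k" "k < n"
  shows "n dvd k \<longleftrightarrow> k = 0 \<or> k = - n"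
proof
  assume "n dvd k"
  then obtain c where c: "k = n * c" by (auto simp: dvd_def)
  have n: "0 < n" using assms by simp
  then have "n * c < n * 1" "n * (-1) \<le> n * c" using assms c by auto
  then have "c < 1" "-1 \<le> c" using n by (simp_all only: mult_less_cancel_left_pos mult_le_cancel_left_pos)
  then have "c = 0 \<or> c = -1" by auto
  then show "k = 0 \<or> k = - n" using c by auto
qed auto

context multigraph_block
begin

text \<open>An induced cycle of length \<open>n\<close>, indexed periodically by all integers so
  that a change of base point is a plain shift of the index. Length three is left to the clique
  case.\<close>

definition ring :: "int \<Rightarrow> (int \<Rightarrow> 'a) \<Rightarrow> bool" where
  "ring n x \<longleftrightarrow> 4 \<le> n \<and> (\<forall>i j. x i = x j \<longleftrightarrow> n dvd i - j) \<and>
     (\<forall>i j. adj (x i) (x j) \<longleftrightarrow> n dvd i - j - 1 \<or> n dvd i - j + 1)"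

lemma ring_size: "ring n x \<Longrightarrow> 4 \<le> n"
  and ring_eq: "ring n x \<Longrightarrow> x i = x j \<longleftrightarrow> n dvd i - j"
  and ring_adj: "ring n x \<Longrightarrow> adj (x i) (x j) \<longleftrightarrow> n dvd i - j - 1 \<or> n dvd i - j + 1"
  by (simp_all add: ring_def)

lemma ring_shift: "ring n x \<Longrightarrow> ring n (\<lambda>i. x (i + k))"
  by (simp add: ring_def algebra_simps)

lemma ring_mod: "ring n x \<Longrightarrow> x (i mod n) = x i"
  by (simp add: ring_eq mod_eq_dvd_iff[symmetric])

lemma ring_add: "ring n x \<Longrightarrow> x (i + n) = x i"
  by (simp add: ring_eq)

lemma ring_inj: "ring n x \<Longrightarrow> 0 \<le> i \<Longrightarrow> i < n \<Longrightarrow> 0 \<le> j \<Longrightarrow> j < n \<Longrightarrow> x i = x j \<longleftrightarrow> i = j"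
  using dvd_int_iff[of n "i - j"] by (auto simp: ring_eq)

text \<open>Unrolls one period to natural indices, in the shape that \<open>slide_path\<close>,
  \<open>rotate\<close> and \<open>rotation_colors\<close> expect with
  \<open>m = n - 1\<close>.\<close>

lemma ring_path:
  assumes "ring n x"
  shows "inj_on (\<lambda>k. x (int k)) {..nat (n - 1)}"
    and "\<And>k. k < nat (n - 1) \<Longrightarrow> adj (x (int k)) (x (int (Suc k)))"
    and "adj (x (int (nat (n - 1)))) (x (int 0))"
    and "\<And>k. 1 < k \<Longrightarrow> k < nat (n - 1) \<Longrightarrow> \<not> adj (x (int 0)) (x (int k))"
    and "2 \<le> nat (n - 1)"
proof -
  have n: "4 \<le> n" using assms by (rule ring_size)
  show "inj_on (\<lambda>k. x (int k)) {..nat (n - 1)}"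
  proof (rule inj_onI)
    fix a b assume "a \<in> {..nat (n - 1)}" "b \<in> {..nat (n - 1)}" "x (int a) = x (int b)"
    then show "a = b" using ring_inj[OF assms, of "int a" "int b"] n by auto
  qed
  show "adj (x (int k)) (x (int (Suc k)))" if "k < nat (n - 1)" for k
    using ring_adj[OF assms] by simp
  show "adj (x (int (nat (n - 1)))) (x (int 0))"
    using ring_adj[OF assms] n by simp
  show "\<not> adj (x (int 0)) (x (int k))" if "1 < k" "k < nat (n - 1)" for k
    using ring_adj[OF assms, of 0 "int k"] dvd_int_iff[of n "- int k - 1"] dvd_int_iff[of n "- int k + 1"]
      that n by auto
  show "2 \<le> nat (n - 1)" using n by simp
qed

lemma ring_rotation:
  assumes "ring n x" "good \<phi> (x 0)"
  shows "\<phi> (x 2) = \<phi> (x (n - 1))"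
    and "\<phi> (x 1) \<noteq> \<phi> (x (n - 1)) \<Longrightarrow> \<mu> (x 0) (x 1) = \<mu> (x 0) (x (n - 1))"
proof -
  have n: "int (nat (n - 1)) = n - 1" using ring_size[OF assms(1)] by simp
  have g: "good \<phi> (x (int 0))" using assms(2) by simp
  note rc = rotation_colors[of \<phi> "\<lambda>k. x (int k)", OF g ring_path(1)[OF assms(1)] ring_path(2)[OF assms(1)]
      ring_path(3)[OF assms(1)] ring_path(5)[OF assms(1)] ring_path(4)[OF assms(1)]]
  show "\<phi> (x 2) = \<phi> (x (n - 1))" using rc(1) n by simp
  show "\<phi> (x 1) \<noteq> \<phi> (x (n - 1)) \<Longrightarrow> \<mu> (x 0) (x 1) = \<mu> (x 0) (x (n - 1))" using rc(2) n by simp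
qed

lemma ring_slide:
  assumes "ring n x" "good \<phi> (x 0)" "0 \<le> j" "j < n"
  shows "\<exists>\<psi>. good \<psi> (x j) \<and> (\<forall>i. 0 \<le> i \<and> i < j \<longrightarrow> \<psi> (x i) = \<phi> (x (i + 1))) \<and>
    (\<forall>i. j \<le> i \<and> i < n \<longrightarrow> \<psi> (x i) = \<phi> (x i))"
proof -
  have g: "good \<phi> (x (int 0))" using assms(2) by simp
  have "nat j \<le> nat (n - 1)" using assms by simp
  from slide_path[of \<phi> "\<lambda>k. x (int k)", OF g ring_path(1)[OF assms(1)] ring_path(2)[OF assms(1)] this]
  obtain \<psi> where \<psi>: "good \<psi> (x (int (nat j))) \<and> (\<forall>i<nat j. \<psi> (x (int i)) = \<phi> (x (int (Suc i)))) \<and>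
    (\<forall>y. y \<notin> (\<lambda>k. x (int k)) ` {..<nat j} \<longrightarrow> \<psi> y = \<phi> y)" ..
  have "good \<psi> (x j)" using \<psi> assms by simp
  moreover have "\<psi> (x i) = \<phi> (x (i + 1))" if "0 \<le> i" "i < j" for i
  proof -
    have "nat i < nat j" using that by simp
    with \<psi> have "\<psi> (x (int (nat i))) = \<phi> (x (int (Suc (nat i))))" by blast
    moreover have "int (nat i) = i" "int (Suc (nat i)) = i + 1" using that by auto
    ultimately show ?thesis by (simp only:)
  qed
  moreover have "\<psi> (x i) = \<phi> (x i)" if "j \<le> i" "i < n" for i
  proof -
    have "x i \<notin> (\<lambda>k. x (int k)) ` {..<nat j}"
    proof
      assume "x i \<in> (\<lambda>k. x (int k)) ` {..<nat j}"
      then obtain k where "k < nat j" "x i = x (int k)" by auto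
      then show False using ring_inj[OF assms(1), of i "int k"] that assms by auto
    qed
    then show ?thesis using \<psi> by simp
  qed
  ultimately show ?thesis by blast
qed

text \<open>The hole is moved to \<open>x j\<close> and rotated from there. Behind it,
  \<open>x (j - 1)\<close> now carries \<open>\<phi> (x j)\<close>; ahead, \<open>x (j + 1)\<close>
  and \<open>x (j + 2)\<close> are untouched as long as their indices stay below \<open>n\<close>,
  which the bounds on \<open>j\<close> ensure.\<close>

lemma ring_alternating:
  assumes "ring n x" "good \<phi> (x 0)" "1 \<le> j"
  shows "j \<le> n - 3 \<Longrightarrow> \<phi> (x (j + 2)) = \<phi> (x j)"
    and "j \<le> n - 2 \<Longrightarrow> \<phi> (x (j + 1)) \<noteq> \<phi> (x j) \<Longrightarrow> \<mu> (x j) (x (j + 1)) = \<mu> (x j) (x (j - 1))"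
proof -
  have *: "(j \<le> n - 3 \<longrightarrow> \<phi> (x (j + 2)) = \<phi> (x j)) \<and>
    (\<phi> (x (j + 1)) \<noteq> \<phi> (x j) \<longrightarrow> \<mu> (x j) (x (j + 1)) = \<mu> (x j) (x (j - 1)))" if "j \<le> n - 2"
  proof -
    have "0 \<le> j" "j < n" using assms(3) that by auto
    from ring_slide[OF assms(1,2) this]
    obtain \<psi> where \<psi>: "good \<psi> (x j) \<and> (\<forall>i. 0 \<le> i \<and> i < j \<longrightarrow> \<psi> (x i) = \<phi> (x (i + 1))) \<and>
      (\<forall>i. j \<le> i \<and> i < n \<longrightarrow> \<psi> (x i) = \<phi> (x i))" ..
    have g: "good \<psi> ((\<lambda>i. x (i + j)) 0)" using \<psi> by simp
    note rot = ring_rotation[OF ring_shift[OF assms(1), of j] g]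
    have e: "x (n - 1 + j) = x (j - 1)" using ring_add[OF assms(1), of "j - 1"] by (simp add: algebra_simps)
    have p: "\<psi> (x (j - 1)) = \<phi> (x j)" using \<psi>[THEN conjunct2, THEN conjunct1, rule_format, of "j - 1"] assms(3) by simp
    have q: "\<psi> (x i) = \<phi> (x i)" if "j \<le> i" "i < n" for i using \<psi> that by blast
    have "\<phi> (x (j + 2)) = \<phi> (x j)" if "j \<le> n - 3"
      using rot(1) e p q[of "j + 2"] that by (simp add: add.commute)
    moreover have "\<mu> (x j) (x (j + 1)) = \<mu> (x j) (x (j - 1))" if "\<phi> (x (j + 1)) \<noteq> \<phi> (x j)"
      using rot(2) e p q[of "j + 1"] that \<open>j \<le> n - 2\<close> by (simp add: add.commute)
    ultimately show ?thesis by blast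
  qed
  show "j \<le> n - 3 \<Longrightarrow> \<phi> (x (j + 2)) = \<phi> (x j)" using * by simp
  show "j \<le> n - 2 \<Longrightarrow> \<phi> (x (j + 1)) \<noteq> \<phi> (x j) \<Longrightarrow> \<mu> (x j) (x (j + 1)) = \<mu> (x j) (x (j - 1))"
    using * by simp
qed

definition colored_ring :: "int \<Rightarrow> (int \<Rightarrow> 'a) \<Rightarrow> ('a \<Rightarrow> 'c) \<Rightarrow> bool" where
  "colored_ring n x \<phi> \<longleftrightarrow> ring n x \<and> good \<phi> (x 0) \<and> \<phi> (x 1) \<noteq> \<phi> (x (n - 1))"

lemma colored_ring_colors:
  assumes "colored_ring n x \<phi>"
  shows "1 + 2 * int k < n \<Longrightarrow> \<phi> (x (1 + 2 * int k)) = \<phi> (x 1)"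
    and "2 + 2 * int k < n \<Longrightarrow> \<phi> (x (2 + 2 * int k)) = \<phi> (x 2)"
proof -
  have r: "ring n x" "good \<phi> (x 0)" using assms by (auto simp: colored_ring_def)
  show "1 + 2 * int k < n \<Longrightarrow> \<phi> (x (1 + 2 * int k)) = \<phi> (x 1)"
  proof (induction k)
    case (Suc k)
    then show ?case using ring_alternating(1)[OF r, of "1 + 2 * int k"] by (simp add: algebra_simps)
  qed simp
  show "2 + 2 * int k < n \<Longrightarrow> \<phi> (x (2 + 2 * int k)) = \<phi> (x 2)"
  proof (induction k)
    case (Suc k)
    then show ?case using ring_alternating(1)[OF r, of "2 + 2 * int k"] by (simp add: algebra_simps)
  qed simp
qed

text \<open>Colours depend only on the parity of the index, and
  \<open>\<phi> (x 2) = \<phi> (x (n - 1))\<close> differs from \<open>\<phi> (x 1)\<close>.\<close>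

lemma colored_ring_step:
  assumes "colored_ring n x \<phi>" "1 \<le> i" "i + 1 < n"
  shows "\<phi> (x (i + 1)) \<noteq> \<phi> (x i)"
proof -
  have ne: "\<phi> (x 1) \<noteq> \<phi> (x 2)" using assms ring_rotation(1)[of n x \<phi>] by (auto simp: colored_ring_def)
  show ?thesis
  proof (cases "even i")
    case True
    then obtain l where l: "i = 2 * l" by blast
    define k where "k = nat (l - 1)"
    have "i = 2 + 2 * int k" "i + 1 = 1 + 2 * int (Suc k)" using l assms by (auto simp: k_def)
    then show ?thesis using colored_ring_colors(1)[OF assms(1), of "Suc k"]
      colored_ring_colors(2)[OF assms(1), of k] ne assms by auto
  next
    case False
    then obtain l where l: "i = 2 * l + 1" by (rule oddE)
    define k where "k = nat l"
    have "i = 1 + 2 * int k" "i + 1 = 2 + 2 * int k" using l assms by (auto simp: k_def)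
    then show ?thesis using colored_ring_colors(1)[OF assms(1), of k]
      colored_ring_colors(2)[OF assms(1), of k] ne assms by auto
  qed
qed

text \<open>For even \<open>n\<close> the index \<open>n - 1\<close> is odd, so
  \<open>x (n - 1)\<close> would have the colour of \<open>x 1\<close>.\<close>

lemma colored_ring_odd:
  assumes "colored_ring n x \<phi>"
  shows "odd n" "5 \<le> n"
proof -
  have n: "4 \<le> n" using assms ring_size by (auto simp: colored_ring_def)
  show "odd n"
  proof
    assume "even n"
    then obtain l where l: "n = 2 * l" by blast
    then have "n - 1 = 1 + 2 * int (nat (l - 1))" using n by auto
    then show False using colored_ring_colors(1)[OF assms, of "nat (l - 1)"] assms n
      by (auto simp: colored_ring_def)
  qed
  then show "5 \<le> n" using n by (cases "n = 4") auto
qed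

text \<open>After the slide to \<open>x j\<close>, with \<open>0 < j < n - 1\<close>, the two
  neighbours of the hole carry the former colours of \<open>x j\<close> and
  \<open>x (j + 1)\<close>, which differ by alternation.\<close>

lemma colored_ring_shift:
  assumes "colored_ring n x \<phi>" "0 \<le> j" "j < n"
  shows "\<exists>\<psi>. colored_ring n (\<lambda>i. x (i + j)) \<psi>"
proof (cases "j = 0")
  case True
  then show ?thesis using assms by auto
next
  case False
  have r: "ring n x" "good \<phi> (x 0)" using assms by (auto simp: colored_ring_def)
  have n: "5 \<le> n" using colored_ring_odd assms by blast
  obtain \<psi> where \<psi>: "good \<psi> (x j) \<and> (\<forall>i. 0 \<le> i \<and> i < j \<longrightarrow> \<psi> (x i) = \<phi> (x (i + 1))) \<and>
      (\<forall>i. j \<le> i \<and> i < n \<longrightarrow> \<psi> (x i) = \<phi> (x i))"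
    using ring_slide[OF r assms(2,3)] ..
  have p: "\<psi> (x i) = \<phi> (x (i + 1))" if "0 \<le> i" "i < j" for i using \<psi> that by blast
  have e: "x (n - 1 + j) = x (j - 1)" using ring_add[OF r(1), of "j - 1"] by (simp add: algebra_simps)
  have "\<psi> (x (1 + j)) \<noteq> \<psi> (x (j - 1))"
  proof (cases "j = n - 1")
    case True
    \<comment> \<open>The index wraps around: \<open>x 0\<close> received the colour of
      \<open>x 1\<close> in the first slide, and \<open>x (j - 1)\<close> that of
      \<open>x (n - 1)\<close>.\<close>
    have "x (1 + j) = x 0" using ring_add[OF r(1), of 0] True by simp
    then show ?thesis using p[of 0] p[of "j - 1"] True n assms(1) by (simp add: colored_ring_def)
  next
    case j: False
    have "\<psi> (x (1 + j)) = \<phi> (x (j + 1))" using \<psi> j assms by (simp add: add.commute)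
    then show ?thesis using p[of "j - 1"] colored_ring_step[OF assms(1), of j] j False assms by simp
  qed
  then have "colored_ring n (\<lambda>i. x (i + j)) \<psi>"
    using \<psi> ring_shift[OF r(1), of j] e by (simp add: colored_ring_def)
  then show ?thesis by blast
qed

text \<open>With the hole at a ring vertex, \<open>ring_rotation\<close> equates the multiplicities
  towards its two ring neighbours; this is carried once around the ring.\<close>

lemma colored_ring_mult:
  assumes "colored_ring n x \<phi>"
  shows "\<mu> (x i) (x (i + 1)) = \<mu> (x 0) (x 1)"
proof -
  have r: "ring n x" using assms by (auto simp: colored_ring_def)
  have n: "5 \<le> n" using colored_ring_odd assms by blast
  have "\<mu> (x (int k)) (x (int k + 1)) = \<mu> (x 0) (x 1)" if "int k < n" for k
    using that
  proof (induction k)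
    case (Suc k)
    define j where "j = int (Suc k)"
    obtain \<psi> where \<psi>: "colored_ring n (\<lambda>i. x (i + j)) \<psi>"
      using colored_ring_shift[OF assms, of j] Suc.prems by (auto simp: j_def)
    then have "\<mu> (x (0 + j)) (x (1 + j)) = \<mu> (x (0 + j)) (x (n - 1 + j))"
      using ring_rotation(2)[of n "\<lambda>i. x (i + j)" \<psi>] by (auto simp: colored_ring_def)
    moreover have "x (n - 1 + j) = x (j - 1)"
      using ring_add[OF r, of "j - 1"] by (simp add: algebra_simps)
    ultimately have "\<mu> (x j) (x (j + 1)) = \<mu> (x j) (x (j - 1))" by (simp add: add.commute)
    also have "\<dots> = \<mu> (x (int k)) (x (int k + 1))"
      using \<mu>_sym[of "x j" "x (j - 1)"] by (simp add: j_def add.commute)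
    finally show ?case using Suc by (simp add: j_def)
  qed simp
  from this[of "nat (i mod n)"] have "\<mu> (x (i mod n)) (x (i mod n + 1)) = \<mu> (x 0) (x 1)" using n by simp
  moreover have "x (i mod n) = x i" by (rule ring_mod[OF r])
  moreover have "x (i mod n + 1) = x (i + 1)"
    using ring_mod[OF r, of "i mod n + 1"] ring_mod[OF r, of "i + 1"] by (simp add: mod_add_left_eq)
  ultimately show ?thesis by simp
qed

text \<open>The colouring with the hole at \<open>x 0\<close> and the one obtained by sending the hole once around the ring
  differ at every other vertex of the ring. Both admit the same ear, and after travelling along it
  the colour of \<open>x 0\<close> would have to fit into both alternating patterns.\<close>

lemma colored_ring_spans:
  assumes "colored_ring n x\<^sub>0 \<phi>\<^sub>0"
  shows "range x\<^sub>0 = V"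
proof (rule ccontr)
  assume "range x\<^sub>0 \<noteq> V"
  have r0: "ring n x\<^sub>0" using assms by (simp add: colored_ring_def)
  have n: "5 \<le> n" using colored_ring_odd assms by blast
  have sub: "range x \<subseteq> V" if "ring n x" for x
  proof -
    have "adj (x i) (x (i + 1))" for i using ring_adj[OF that] by simp
    then show ?thesis using adj_in_V by blast
  qed
  obtain e where e: "e \<in> E" "I e \<inter> range x\<^sub>0 \<noteq> {}" "I e - range x\<^sub>0 \<noteq> {}"
    using connected[OF sub[OF r0] _ \<open>range x\<^sub>0 \<noteq> V\<close>] by blast
  obtain i0 z where i0: "x\<^sub>0 i0 \<in> I e" and z: "z \<in> I e" "z \<notin> range x\<^sub>0" using e by blast
  define j where "j = i0 mod n"
  have j: "0 \<le> j" "j < n" "x\<^sub>0 j = x\<^sub>0 i0" using n ring_mod[OF r0] by (auto simp: j_def)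
  \<comment> \<open>Rebased so that the ear leaves the ring at index 0.\<close>
  define x where "x = (\<lambda>i. x\<^sub>0 (i + j))"
  obtain \<phi> where \<phi>: "colored_ring n x \<phi>"
    using colored_ring_shift[OF assms j(1,2)] by (auto simp: x_def)
  have r: "ring n x" and g: "good \<phi> (x 0)" using \<phi> by (auto simp: colored_ring_def)
  have zx: "z \<notin> range x" using z by (auto simp: x_def)
  have "x 0 = x\<^sub>0 i0" using j by (simp add: x_def)
  then have az: "adj (x 0) z" using i0 e z by (auto simp: adj_def)
  have zV: "z \<in> V" using az adj_in_V by blast
  have x0V: "x 0 \<in> V" using az adj_in_V by blast
  obtain \<phi>' where \<phi>': "good \<phi>' (x (int 0)) \<and>
    (\<forall>i. 0 < i \<and> i < nat (n - 1) \<longrightarrow> \<phi>' (x (int i)) = \<phi> (x (int (Suc i)))) \<and>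
    \<phi>' (x (int (nat (n - 1)))) = \<phi> (x (int 1)) \<and> (\<forall>y. y \<notin> (\<lambda>k. x (int k)) ` {..nat (n - 1)} \<longrightarrow> \<phi>' y = \<phi> y)"
    using rotate[of \<phi> "\<lambda>k. x (int k)", OF _ ring_path(1-3,5)[OF r]] g by auto
  have g': "good \<phi>' (x 0)" using \<phi>' by simp
  have off: "\<phi>' y = \<phi> y" if "y \<notin> range x" for y
  proof -
    have "y \<notin> (\<lambda>k. x (int k)) ` {..nat (n - 1)}" using that by auto
    then show ?thesis using \<phi>' by simp
  qed
  \<comment> \<open>The round trip shifts the alternating pattern by one place and puts the colour
    of \<open>x 1\<close> on \<open>x (n - 1)\<close>.\<close>
  have differ: "\<phi>' (x i) \<noteq> \<phi> (x i)" if "1 \<le> i" "i < n" for i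
  proof (cases "i = n - 1")
    case True
    then have "\<phi>' (x i) = \<phi> (x 1)" using \<phi>' n by simp
    then show ?thesis using True \<phi> by (simp add: colored_ring_def)
  next
    case False
    have "0 < nat i \<and> nat i < nat (n - 1)" using that False by simp
    then have "\<phi>' (x (int (nat i))) = \<phi> (x (int (Suc (nat i))))" using \<phi>' by blast
    moreover have "int (nat i) = i" "int (Suc (nat i)) = i + 1" using that by auto
    ultimately have "\<phi>' (x i) = \<phi> (x (i + 1))" by (simp only:)
    then show ?thesis using colored_ring_step[OF \<phi>, of i] that False by simp
  qed
  define \<Phi> where "\<Phi> = {\<phi>(x 0 := \<phi> z), \<phi>'(x 0 := \<phi> z)}"
  have start: "\<forall>\<chi>\<in>\<Phi>. good (\<lambda>y. if y \<in> range x then \<chi> y else \<phi> y) z"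
  proof
    fix \<chi> assume "\<chi> \<in> \<Phi>"
    then consider "\<chi> = \<phi>(x 0 := \<phi> z)" | "\<chi> = \<phi>'(x 0 := \<phi> z)" by (auto simp: \<Phi>_def)
    then have "good \<chi> z \<and> (\<forall>y. y \<notin> range x \<longrightarrow> \<chi> y = \<phi> y)"
    proof cases
      case 1
      then show ?thesis using slide[OF g az] by auto
    next
      case 2
      then show ?thesis using slide[OF g' az] off[OF zx] off by auto
    qed
    moreover from this have "(\<lambda>y. if y \<in> range x then \<chi> y else \<phi> y) = \<chi>" by auto
    ultimately show "good (\<lambda>y. if y \<in> range x then \<chi> y else \<phi> y) z" by simp
  qed
  have "x 1 \<noteq> x 0" using ring_inj[OF r, of 1 0] n by simp
  then have ne: "range x \<noteq> {x 0}" by blast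
  obtain h' w' \<psi> where h': "h' \<in> V - range x" and w': "w' \<in> range x - {x 0}" and hw: "adj h' w'"
    and gd: "\<And>\<chi>. \<chi> \<in> \<Phi> \<Longrightarrow> good (\<lambda>y. if y \<in> range x then \<chi> y else \<psi> y) h'"
    using travel[OF x0V _ sub[OF r] ne _ start] zV zx by blast
  obtain i1 where "w' = x i1" using w' by auto
  define i where "i = i1 mod n"
  have w'i: "w' = x i" using ring_mod[OF r, of i1] \<open>w' = x i1\<close> by (simp add: i_def)
  have "0 \<le> i" "i < n" using n by (auto simp: i_def)
  moreover have "i \<noteq> 0" using w' w'i by auto
  ultimately have i: "1 \<le> i" "i < n" by auto
  \<comment> \<open>Counted from the new hole \<open>x i\<close>, the vertex \<open>x 0\<close> has
    index \<open>n - i\<close>, and alternation links indices \<open>j\<close> and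
    \<open>j + 2\<close> for \<open>1 \<le> j \<le> n - 3\<close>. So \<open>x 0\<close> is paired
    with \<open>x 2\<close> if \<open>3 \<le> i\<close> and with \<open>x (n - 2)\<close> otherwise,
    where \<open>5 \<le> n\<close> leaves room. The choice of \<open>k\<close> depends on
    \<open>i\<close> alone, hence serves both members of \<open>\<Phi>\<close>.\<close>
  have key: "\<exists>k. 1 \<le> k \<and> k < n \<and> (\<forall>\<chi>\<in>\<Phi>. \<chi> (x k) = \<chi> (x 0))"
  proof -
    define \<eta> where "\<eta> \<chi> = (\<lambda>y. if y \<in> range x then \<chi> y else \<psi> y)(h' := \<chi> w')" for \<chi> :: "'a \<Rightarrow> 'c"
    have \<eta>: "good (\<eta> \<chi>) (x i)" if "\<chi> \<in> \<Phi>" for \<chi>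
      using slide[OF gd[OF that] hw] w' by (simp add: \<eta>_def w'i)
    have \<eta>x: "\<eta> \<chi> (x l) = \<chi> (x l)" for \<chi> l using h' by (auto simp: \<eta>_def)
    have gi: "good (\<eta> \<chi>) ((\<lambda>l. x (l + i)) 0)" if "\<chi> \<in> \<Phi>" for \<chi> using \<eta>[OF that] by simp
    note alt = ring_alternating(1)[OF ring_shift[OF r, of i] gi]
    show ?thesis
    proof (cases "3 \<le> i")
      case True
      have "\<chi> (x 2) = \<chi> (x 0)" if "\<chi> \<in> \<Phi>" for \<chi>
      proof -
        have "\<eta> \<chi> (x (n - i + 2 + i)) = \<eta> \<chi> (x (n - i + i))"
          by (rule alt[OF that]) (use True i in auto)
        moreover have "x (n - i + 2 + i) = x 2" "x (n - i + i) = x 0"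
          using ring_add[OF r, of 2] ring_add[OF r, of 0] by (simp_all add: algebra_simps)
        ultimately show ?thesis using \<eta>x by metis
      qed
      then show ?thesis using n by (intro exI[of _ 2]) auto
    next
      case False
      have "\<chi> (x (n - 2)) = \<chi> (x 0)" if "\<chi> \<in> \<Phi>" for \<chi>
      proof -
        have "\<eta> \<chi> (x (n - i - 2 + 2 + i)) = \<eta> \<chi> (x (n - i - 2 + i))"
          by (rule alt[OF that]) (use False i n in auto)
        moreover have "x (n - i - 2 + 2 + i) = x 0" "x (n - i - 2 + i) = x (n - 2)"
          using ring_add[OF r, of 0] by (simp_all add: algebra_simps)
        ultimately show ?thesis using \<eta>x by metis
      qed
      then show ?thesis using n by (intro exI[of _ "n - 2"]) auto
    qed
  qed
  then obtain k where k: "1 \<le> k" "k < n" "\<And>\<chi>. \<chi> \<in> \<Phi> \<Longrightarrow> \<chi> (x k) = \<chi> (x 0)" by blast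
  have "x k \<noteq> x 0" using ring_inj[OF r, of k 0] k by simp
  then have "\<phi> (x k) = \<phi> z" "\<phi>' (x k) = \<phi> z"
    using k(3)[of "\<phi>(x 0 := \<phi> z)"] k(3)[of "\<phi>'(x 0 := \<phi> z)"] by (auto simp: \<Phi>_def)
  then show False using differ[OF k(1,2)] by simp
qed

lemma ringI:
  fixes X :: "nat \<Rightarrow> 'a"
  assumes m: "2 \<le> m"
    and inj: "\<And>i j. i \<le> m + 1 \<Longrightarrow> j \<le> m + 1 \<Longrightarrow> X i = X j \<longleftrightarrow> i = j"
    and adj: "\<And>i j. i < j \<Longrightarrow> j \<le> m + 1 \<Longrightarrow> adj (X i) (X j) \<longleftrightarrow> j = Suc i \<or> (i = 0 \<and> j = m + 1)"
  shows "ring (int m + 2) (\<lambda>i. X (nat (i mod (int m + 2))))"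
proof -
  define n where "n = int m + 2"
  have n: "4 \<le> n" using m by (simp add: n_def)
  have b: "0 \<le> i mod n" "i mod n < n" for i using n by auto
  have nb: "nat (i mod n) \<le> m + 1" for i using b(2)[of i] unfolding n_def by linarith
  have eq: "X (nat (i mod n)) = X (nat (j mod n)) \<longleftrightarrow> n dvd i - j" for i j
    using inj[OF nb nb, of i j] b(1)[of i] b(1)[of j]
    by (simp add: eq_nat_nat_iff mod_eq_dvd_iff)
  have adj': "adj (X a) (X c) \<longleftrightarrow> c = Suc a \<or> a = Suc c \<or> (a = 0 \<and> c = m + 1) \<or> (c = 0 \<and> a = m + 1)"
    if "a \<le> m + 1" "c \<le> m + 1" for a c
  proof -
    consider "a < c" | "a = c" | "c < a" by linarith
    then show ?thesis
    proof cases
      case 1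
      then show ?thesis using adj[of a c] that by auto
    next
      case 2
      then show ?thesis using m by (auto simp: adj_def)
    next
      case 3
      have "adj (X a) (X c) \<longleftrightarrow> adj (X c) (X a)" using adj_sym by blast
      then show ?thesis using adj[of c a] 3 that by auto
    qed
  qed
  have "adj (X (nat (i mod n))) (X (nat (j mod n))) \<longleftrightarrow> n dvd i - j - 1 \<or> n dvd i - j + 1" for i j
  proof -
    define a c where "a = i mod n" and "c = j mod n"
    have a: "0 \<le> a" "a < n" and c: "0 \<le> c" "c < n" using b by (auto simp: a_def c_def)
    define k where "k = i div n - j div n"
    have "i = a + n * (i div n)" "j = c + n * (j div n)" by (simp_all add: a_def c_def)
    then have "i - j - 1 = (a - c - 1) + n * k" "i - j + 1 = (a - c + 1) + n * k"
      by (simp_all add: k_def right_diff_distrib)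
    then have d: "n dvd i - j - 1 \<longleftrightarrow> n dvd a - c - 1" "n dvd i - j + 1 \<longleftrightarrow> n dvd a - c + 1"
      by (simp_all only: dvd_add_times_triv_right_iff mult.commute[of n k])
    have "n dvd a - c - 1 \<longleftrightarrow> a - c - 1 = 0 \<or> a - c - 1 = - n"
      by (rule dvd_int_iff) (use a c in auto)
    then have d1: "n dvd a - c - 1 \<longleftrightarrow> a = c + 1 \<or> a = c + 1 - n" by linarith
    have "n dvd - (a - c + 1) \<longleftrightarrow> - (a - c + 1) = 0 \<or> - (a - c + 1) = - n"
      by (rule dvd_int_iff) (use a c in auto)
    then have d2: "n dvd a - c + 1 \<longleftrightarrow> c = a + 1 \<or> c = a + 1 - n"
      unfolding dvd_minus_iff by linarith
    have "n dvd i - j - 1 \<or> n dvd i - j + 1 \<longleftrightarrow>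
      a = c + 1 \<or> a = c + 1 - n \<or> c = a + 1 \<or> c = a + 1 - n" unfolding d d1 d2 by blast
    also have "\<dots> \<longleftrightarrow> nat c = Suc (nat a) \<or> nat a = Suc (nat c) \<or> (nat a = 0 \<and> nat c = m + 1)
      \<or> (nat c = 0 \<and> nat a = m + 1)"
    proof -
      obtain p q where p: "a = int p" "c = int q" using a(1) c(1) by (metis nonneg_int_cases)
      have "p \<le> m + 1" "q \<le> m + 1" using a(2) c(2) p by (auto simp: n_def)
      then have "a = c + 1 \<longleftrightarrow> p = Suc q" "c = a + 1 \<longleftrightarrow> q = Suc p"
        "a = c + 1 - n \<longleftrightarrow> p = 0 \<and> q = m + 1" "c = a + 1 - n \<longleftrightarrow> q = 0 \<and> p = m + 1"
        using p by (auto simp: n_def)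
      then show ?thesis using p by auto
    qed
    finally show ?thesis using adj'[OF nb nb, of i j] unfolding a_def c_def by simp
  qed
  then show ?thesis using eq n unfolding ring_def n_def[symmetric] by simp
qed

text \<open>A shortest walk off \<open>w\<close> between differently coloured neighbours of
  \<open>w\<close> is an induced path without inner neighbours of \<open>w\<close>. Together with
  \<open>w\<close> it is an induced cycle of length \<open>m + 2\<close>, and
  \<open>no_triangle\<close> excludes \<open>m = 1\<close>.\<close>

lemma colored_ring_exists:
  assumes g: "good \<phi> w" "adj w a" "adj w b" "\<phi> a \<noteq> \<phi> b"
    and no_triangle: "\<And>a b. adj w a \<Longrightarrow> adj a b \<Longrightarrow> adj b w \<Longrightarrow> \<phi> a = \<phi> b"
  shows "\<exists>n x. colored_ring n x \<phi>"
proof -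
  define rel where "rel u v \<longleftrightarrow> u \<noteq> w \<and> v \<noteq> w \<and> adj u v" for u v
  define far where "far m \<longleftrightarrow> (\<exists>x y. adj w x \<and> adj w y \<and> \<phi> x \<noteq> \<phi> y \<and> (rel ^^ m) x y)" for m
  have "rel\<^sup>*\<^sup>* a b"
  proof (rule ccontr)
    assume no: "\<not> rel\<^sup>*\<^sup>* a b"
    define R where "R = {y \<in> V - {w}. rel\<^sup>*\<^sup>* a y}"
    have "a \<in> R" using g adj_in_V by (auto simp: R_def adj_def)
    moreover have "b \<in> V - {w}" "b \<notin> R" using g adj_in_V no by (auto simp: R_def adj_def)
    ultimately obtain e where e: "e \<in> E" "I e \<inter> R \<noteq> {}" "I e - R - {w} \<noteq> {}"
      using nonseparable[OF good_in_V[OF g(1)], of R] by (auto simp: R_def)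
    then obtain y z where y: "y \<in> I e" "y \<in> R" and z: "z \<in> I e" "z \<notin> R" "z \<noteq> w" by auto
    have "adj y z" using e y z by (auto simp: adj_def)
    moreover have "y \<noteq> w" using y by (simp add: R_def)
    ultimately have "rel y z" using z by (simp add: rel_def)
    then have "rel\<^sup>*\<^sup>* a z" using y by (auto simp: R_def)
    then show False using z \<open>adj y z\<close> adj_in_V by (auto simp: R_def)
  qed
  then obtain k where "(rel ^^ k) a b" by (auto simp: rtranclp_power)
  then have "far k" using g by (auto simp: far_def)
  define m where "m = (LEAST m. far m)"
  have "far m" unfolding m_def using \<open>far k\<close> by (rule LeastI)
  then obtain p where p: "adj w (p 0)" "adj w (p m)" "\<phi> (p 0) \<noteq> \<phi> (p m)"
    "\<And>i. i < m \<Longrightarrow> rel (p i) (p (Suc i))"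
    unfolding far_def by (auto simp: relpowp_fun_conv)
  have least: "m \<le> k" if "far k" for k unfolding m_def using that by (rule Least_le)
  have seg: "(rel ^^ (j - i)) (p i) (p j)" if "i \<le> j" "j \<le> m" for i j
    unfolding relpowp_fun_conv by (rule exI[of _ "\<lambda>l. p (i + l)"]) (use p(4) that in auto)
  have short: "j - i \<le> d" if "i \<le> j" "j \<le> m" "(rel ^^ d) (p i) (p j)" for i j d
  proof -
    have "(rel ^^ (i + d)) (p 0) (p j)"
      using seg[of 0 i] that by (auto simp: relpowp_add)
    then have "(rel ^^ (i + d + (m - j))) (p 0) (p m)"
      using seg[of j m] that unfolding relpowp_add[of "i + d"] by auto
    then have "m \<le> i + d + (m - j)" using p by (intro least) (auto simp: far_def)
    then show ?thesis using that by linarith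
  qed
  \<comment> \<open>An inner neighbour of \<open>w\<close> would differ in colour from at least one
    end of the walk, so the segment to that end would be a shorter walk of the same kind.\<close>
  have inner: "\<not> adj w (p i)" if "0 < i" "i < m" for i
  proof
    assume "adj w (p i)"
    moreover have "\<phi> (p i) \<noteq> \<phi> (p 0) \<or> \<phi> (p i) \<noteq> \<phi> (p m)" using p(3) by auto
    moreover have "(rel ^^ i) (p 0) (p i)" "(rel ^^ (m - i)) (p i) (p m)"
      using seg[of 0 i] seg[of i m] that by simp_all
    ultimately have "far i \<or> far (m - i)"
      using p(1,2) unfolding far_def by metis
    then show False using least[of i] least[of "m - i"] that by auto
  qed
  have inj: "p i = p j \<longleftrightarrow> i = j" if "i \<le> m" "j \<le> m" for i j
  proof -
    have "i = j" if "i \<le> j" "j \<le> m" "p i = p j" for i j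
      using short[of i j 0] that by simp
    from this[of i j] this[of j i] show ?thesis using that by (cases "i \<le> j") auto
  qed
  have ne: "p i \<noteq> w" if "i \<le> m" for i
  proof (cases i)
    case 0
    then show ?thesis using p(1) by (auto simp: adj_def)
  next
    case (Suc k)
    then show ?thesis using p(4)[of k] that by (simp add: rel_def)
  qed
  have adj: "adj (p i) (p j) \<longleftrightarrow> j = Suc i" if "i < j" "j \<le> m" for i j
  proof
    assume "adj (p i) (p j)"
    then have "rel (p i) (p j)" using ne that by (simp add: rel_def)
    then have "(rel ^^ 1) (p i) (p j)" by (simp only: relpowp_1)
    then show "j = Suc i" using short[of i j 1] that by simp
  next
    assume "j = Suc i"
    then show "adj (p i) (p j)" using p(4)[of i] that by (simp add: rel_def)
  qed
  have "m \<noteq> 0" using p(3) by (cases m) auto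
  moreover have "m \<noteq> 1"
  proof
    assume "m = 1"
    then have "adj (p 0) (p m)" using adj[of 0 1] by simp
    then show False using no_triangle[OF p(1), of "p m"] p adj_sym by blast
  qed
  ultimately have m: "2 \<le> m" by linarith
  define X where "X i = (case i of 0 \<Rightarrow> w | Suc k \<Rightarrow> p k)" for i
  have "ring (int m + 2) (\<lambda>i. X (nat (i mod (int m + 2))))"
  proof (rule ringI[OF m])
    show "X i = X j \<longleftrightarrow> i = j" if "i \<le> m + 1" "j \<le> m + 1" for i j
      using that inj ne ne[symmetric] by (auto simp: X_def split: nat.splits)
    show "adj (X i) (X j) \<longleftrightarrow> j = Suc i \<or> (i = 0 \<and> j = m + 1)" if "i < j" "j \<le> m + 1" for i j
    proof (cases i)
      case (Suc k)
      obtain l where l: "j = Suc l" using \<open>i < j\<close> by (cases j) auto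
      show ?thesis using Suc l that adj[of k l] by (simp add: X_def)
    next
      case 0
      obtain l where l: "j = Suc l" using \<open>i < j\<close> by (cases j) auto
      have "adj w (p l) \<longleftrightarrow> l = 0 \<or> l = m" using inner[of l] p(1,2) that l by (cases "l = m") auto
      then show ?thesis using 0 l by (simp add: X_def)
    qed
  qed
  moreover have "X (nat (0 mod (int m + 2))) = w" by (simp add: X_def)
  moreover have "X (nat (1 mod (int m + 2))) = p 0" by (simp add: X_def)
  moreover have "X (nat ((int m + 2 - 1) mod (int m + 2))) = p m"
  proof -
    have "nat ((int m + 2 - 1) mod (int m + 2)) = Suc m" by simp
    then show ?thesis by (simp add: X_def)
  qed
  ultimately have "colored_ring (int m + 2) (\<lambda>i. X (nat (i mod (int m + 2)))) \<phi>"
    using g(1) p(3) unfolding colored_ring_def by metis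
  then show ?thesis by blast
qed

text \<open>Two positive budgets give the hole neighbours of two colours. The split is whether some
  triangle at the hole carries two colours on its other vertices.\<close>

lemma complete_or_odd_ring:
  assumes "v \<in> V" "f c v > 0" "f d v > 0" "c \<noteq> d"
  shows "(\<exists>t>0. \<forall>x\<in>V. \<forall>y\<in>V. x \<noteq> y \<longrightarrow> \<mu> x y = t) \<or>
    (\<exists>n x t. odd n \<and> 0 < t \<and> ring n x \<and> range x = V \<and> (\<forall>i. \<mu> (x i) (x (i + 1)) = t))"
proof -
  obtain \<phi> where \<phi>: "good \<phi> v" using good_exists assms(1) by blast
  obtain a where a: "adj v a" "\<phi> a = c" using f_pos_obtain[OF \<phi> assms(2)] .
  obtain b where b: "adj v b" "\<phi> b = d" using f_pos_obtain[OF \<phi> assms(3)] .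
  show ?thesis
  proof (cases "\<exists>a b. adj v a \<and> adj a b \<and> adj b v \<and> \<phi> a \<noteq> \<phi> b")
    case True
    then show ?thesis using complete_if_triangle[OF \<phi>] by blast
  next
    case False
    then obtain n x where x: "colored_ring n x \<phi>"
      using colored_ring_exists[OF \<phi> a(1) b(1)] a b assms(4) by blast
    have "ring n x" using x by (simp add: colored_ring_def)
    then have "adj (x 0) (x 1)" using ring_adj by simp
    then have "0 < \<mu> (x 0) (x 1)" by (simp add: adj_iff)
    then show ?thesis
      using colored_ring_odd[OF x] colored_ring_spans[OF x] colored_ring_mult[OF x] \<open>ring n x\<close> by blast
  qed
qed

end

context noncolorable_block
begin

text \<open>The cases are spelled out in terms of \<open>E\<close> and \<open>I\<close> because
  \<open>\<mu>\<close> and \<open>ring\<close> live in a locale that assumes all edges to have size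
  two, which holds here only once two colours have positive budget.\<close>

theorem block_structure:
  assumes "V \<noteq> {}"
  obtains (mono) c where "\<And>v. v \<in> V \<Longrightarrow> card {e \<in> E. v \<in> I e} \<le> f c v"
  | (complete) t where "0 < t" "\<And>e. e \<in> E \<Longrightarrow> card (I e) = 2"
      "\<And>u v. u \<in> V \<Longrightarrow> v \<in> V \<Longrightarrow> u \<noteq> v \<Longrightarrow> card {e \<in> E. I e = {u, v}} = t"
  | (odd_cycle) n t and x :: "int \<Rightarrow> 'v" where "odd n" "4 \<le> n" "0 < t" "\<And>e. e \<in> E \<Longrightarrow> card (I e) = 2"
      "range x = V" "\<And>i j. x i = x j \<longleftrightarrow> n dvd i - j"
      "\<And>i. card {e \<in> E. I e = {x i, x (i + 1)}} = t"
      "\<And>i j e. e \<in> E \<Longrightarrow> I e = {x i, x j} \<Longrightarrow> n dvd i - j - 1 \<or> n dvd i - j + 1"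
proof (cases "\<exists>v\<in>V. \<exists>c d. f c v > 0 \<and> f d v > 0 \<and> c \<noteq> d")
  case False
  obtain v where "v \<in> V" using assms by blast
  then have "\<exists>c. \<forall>v\<in>V. card {e \<in> E. v \<in> I e} \<le> f c v"
    by (rule monochromatic) (use False in blast)
  then show ?thesis using mono by blast
next
  case True
  then obtain v c d where v: "v \<in> V" "f c v > 0" "f d v > 0" "c \<noteq> d" by blast
  have size: "card (I e) = 2" if e: "e \<in> E" for e
  proof -
    obtain u where u: "u \<in> I e" by (rule inc_other[OF e])
    then have "u \<in> V" using inc_V e by blast
    then have "f c u > 0" "f d u > 0" using f_pos_const v by blast+
    then show ?thesis using edge_card_2[OF e u _ _ v(4)] by blast
  qed
  interpret multigraph_block V E I K f by unfold_locales (rule size)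
  from complete_or_odd_ring[OF v] show ?thesis
  proof (elim disjE exE conjE)
    fix t assume "0 < t" "\<forall>x\<in>V. \<forall>y\<in>V. x \<noteq> y \<longrightarrow> \<mu> x y = t"
    then show ?thesis using complete[of t] size by (simp add: \<mu>_def)
  next
    fix n x t assume r: "odd n" "0 < t" "ring n x" "range x = V" "\<forall>i. \<mu> (x i) (x (i + 1)) = t"
    have "n dvd i - j - 1 \<or> n dvd i - j + 1" if "e \<in> E" "I e = {x i, x j}" for i j e
    proof -
      have "x i \<noteq> x j" using size[OF that(1)] that(2) by auto
      then have "adj (x i) (x j)" using that by (auto simp: adj_def)
      then show ?thesis using ring_adj[OF r(3)] by simp
    qed
    then show ?thesis
      using odd_cycle[of n t x] r size ring_size[OF r(3)] ring_eq[OF r(3)] by (simp add: \<mu>_def)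
  qed
qed

end

section \<open>Reduction to blocks\<close>

context weighted_hypergraph
begin

text \<open>An edge leaving \<open>W\<close> can only lie in a colour class if its part outside \<open>W\<close> is already
  monochromatic, so it is charged to that colour.\<close>

lemma restrict:
  fixes \<phi> :: "'v \<Rightarrow> 'c" and W :: "'v set"
  defines "f' \<equiv> \<lambda>c v. f c v - card {e \<in> E. v \<in> I e \<and> \<not> I e \<subseteq> W \<and> (\<forall>x\<in>I e - W. \<phi> x = c)}"
  assumes W: "W \<subseteq> V" and \<phi>: "proper \<phi> (V - W)" and noncol: "\<And>\<psi>. \<not> proper \<psi> V"
    and conn: "\<And>X. X \<subseteq> W \<Longrightarrow> X \<noteq> {} \<Longrightarrow> X \<noteq> W \<Longrightarrow>
        \<exists>e\<in>E. I e \<subseteq> W \<and> I e \<inter> X \<noteq> {} \<and> I e - X \<noteq> {}"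
    and nonsep: "\<And>v X. v \<in> W \<Longrightarrow> X \<subseteq> W - {v} \<Longrightarrow> X \<noteq> {} \<Longrightarrow> X \<noteq> W - {v} \<Longrightarrow>
        \<exists>e\<in>E. I e \<subseteq> W \<and> I e \<inter> X \<noteq> {} \<and> I e - X - {v} \<noteq> {}"
  shows "noncolorable_block W {e \<in> E. I e \<subseteq> W} I K f'"
proof -
  let ?EW = "{e \<in> E. I e \<subseteq> W}"
  define Out where "Out v c = {e \<in> E. v \<in> I e \<and> \<not> I e \<subseteq> W \<and> (\<forall>x\<in>I e - W. \<phi> x = c)}" for v c
  have f': "f' c v = f c v - card (Out v c)" for c v by (simp add: f'_def Out_def)
  have finOut: "finite (Out v c)" for v c using finE by (simp add: Out_def)
  have budget': "card {e \<in> ?EW. v \<in> I e} \<le> (\<Sum>c\<in>K. f' c v)" if v: "v \<in> W" for v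
  proof -
    have "(\<Sum>c\<in>K. card (Out v c)) = card (\<Union>c\<in>K. Out v c)"
      by (rule card_UN_disjoint[symmetric]) (use finK finOut in \<open>auto simp: Out_def\<close>)
    also have "\<dots> \<le> card {e \<in> E. v \<in> I e \<and> \<not> I e \<subseteq> W}"
      by (rule card_mono) (use finE in \<open>auto simp: Out_def\<close>)
    finally have 1: "(\<Sum>c\<in>K. card (Out v c)) \<le> card {e \<in> E. v \<in> I e \<and> \<not> I e \<subseteq> W}" .
    have "{e \<in> E. v \<in> I e} = {e \<in> ?EW. v \<in> I e} \<union> {e \<in> E. v \<in> I e \<and> \<not> I e \<subseteq> W}" by auto
    moreover have "card ({e \<in> ?EW. v \<in> I e} \<union> {e \<in> E. v \<in> I e \<and> \<not> I e \<subseteq> W})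
        = card {e \<in> ?EW. v \<in> I e} + card {e \<in> E. v \<in> I e \<and> \<not> I e \<subseteq> W}"
      by (rule card_Un_disjoint) (use finE in auto)
    ultimately have 2: "card {e \<in> E. v \<in> I e}
        = card {e \<in> ?EW. v \<in> I e} + card {e \<in> E. v \<in> I e \<and> \<not> I e \<subseteq> W}" by (simp only:)
    \<comment> \<open>Truncated subtraction can only make \<open>f' c v\<close> larger, so no bound
      on \<open>card (Out v c)\<close> is required.\<close>
    have "(\<Sum>c\<in>K. f c v) \<le> (\<Sum>c\<in>K. f' c v + card (Out v c))"
      by (rule sum_mono) (simp add: f')
    then show ?thesis using 1 2 budget[of v] v W by (auto simp: sum.distrib)
  qed
  interpret B: weighted_hypergraph W ?EW I K f'
  proof
    show "finite W" using W finV by (rule finite_subset)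
    show "\<exists>e\<in>?EW. I e \<inter> X \<noteq> {} \<and> I e - X \<noteq> {}" if "X \<subseteq> W" "X \<noteq> {}" "X \<noteq> W" for X
      using conn[OF that] by blast
  qed (use finE finK inc_card f_outside budget' in \<open>auto simp: f'\<close>)
  have glue: "proper (\<lambda>x. if x \<in> W then \<psi> x else \<phi> x) V" if \<psi>: "B.proper \<psi> W" for \<psi>
    unfolding proper_def degenerate_def
  proof (intro allI impI)
    fix c T assume T: "T \<subseteq> {v \<in> V. (if v \<in> W then \<psi> v else \<phi> v) = c}" "T \<noteq> {}"
    show "\<exists>v\<in>T. dg T v < f c v"
    proof (cases "T \<inter> W = {}")
      case True
      then have "T \<subseteq> {v \<in> V - W. \<phi> v = c}" using T by (auto split: if_splits)
      then show ?thesis using \<phi> T(2) by (simp add: proper_def degenerate_def)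
    next
      case False
      have "T \<inter> W \<subseteq> {v \<in> W. \<psi> v = c}" using T by (auto split: if_splits)
      then obtain v where v: "v \<in> T \<inter> W" "B.dg (T \<inter> W) v < f' c v"
        using \<psi> False unfolding B.proper_def B.degenerate_def by blast
      \<comment> \<open>An edge at \<open>v\<close> inside \<open>T\<close> either lies in
        \<open>W\<close> or has its part outside \<open>W\<close> in colour \<open>c\<close>. As
        \<open>f' c v\<close> exceeds a degree, it is positive, so the subtraction in it is
        exact.\<close>
      have "{e \<in> E. v \<in> I e \<and> I e \<subseteq> T} \<subseteq> {e \<in> ?EW. v \<in> I e \<and> I e \<subseteq> T \<inter> W} \<union> Out v c"
        using T by (auto simp: Out_def split: if_splits)
      then have "dg T v \<le> card ({e \<in> ?EW. v \<in> I e \<and> I e \<subseteq> T \<inter> W} \<union> Out v c)"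
        unfolding dg_def by (intro card_mono) (use finE finOut in auto)
      also have "\<dots> \<le> B.dg (T \<inter> W) v + card (Out v c)" unfolding B.dg_def by (rule card_Un_le)
      finally show ?thesis using v by (intro bexI[of _ v]) (auto simp: f')
    qed
  qed
  show ?thesis
  proof
    show "\<exists>e\<in>?EW. I e \<inter> X \<noteq> {} \<and> I e - X - {v} \<noteq> {}"
      if "v \<in> W" "X \<subseteq> W - {v}" "X \<noteq> {}" "X \<noteq> W - {v}" for v X
      using nonsep[OF that] by blast
    show "\<not> B.proper \<psi> W" for \<psi> using glue noncol by blast
  qed
qed

end

section \<open>Bricks, blocks and critical hypergraphs\<close>

lemma hg_iso_multiple:
  fixes B :: "('v, 'e) pre_hypergraph" and G :: "('w, 'w set) pre_hypergraph"
  assumes B: "hypergraph B" and G: "inc G = (\<lambda>e. e)" "\<And>s. s \<in> edges G \<Longrightarrow> s \<subseteq> verts G"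
    and y: "bij_betw y (verts G) (verts B)"
    and cover: "\<And>e. e \<in> edges B \<Longrightarrow> \<exists>s\<in>edges G. inc B e = y ` s"
    and mult: "\<And>s. s \<in> edges G \<Longrightarrow> card {e \<in> edges B. inc B e = y ` s} = t"
  shows "hg_iso B (multiple t G)"
proof -
  define g where "g = inv_into (verts G) y"
  have bg: "bij_betw g (verts B) (verts G)" unfolding g_def using y by (rule bij_betw_inv_into)
  have gy: "g ` (y ` s) = s" if "s \<subseteq> verts G" for s
    unfolding g_def using y that by (intro inv_into_image_cancel) (auto simp: bij_betw_def)
  have yg: "y ` s = y ` s' \<longleftrightarrow> s = s'" if "s \<subseteq> verts G" "s' \<subseteq> verts G" for s s'
    using gy[OF that(1)] gy[OF that(2)] by metis
  define A where "A s = {e \<in> edges B. inc B e = y ` s}" for s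
  have "\<exists>h. bij_betw h (A s) {..<t}" if "s \<in> edges G" for s
  proof -
    have "finite (A s)" using B by (simp add: A_def hypergraph_def)
    then show ?thesis using ex_bij_betw_finite_nat mult[OF that] by (auto simp: A_def atLeast0LessThan)
  qed
  then have "\<forall>s\<in>edges G. \<exists>h. bij_betw h (A s) {..<t}" by blast
  from bchoice[OF this] obtain h where h: "\<And>s. s \<in> edges G \<Longrightarrow> bij_betw (h s) (A s) {..<t}" by blast
  have coverA: "\<exists>s\<in>edges G. e \<in> A s" if "e \<in> edges B" for e
    using cover[OF that] that by (simp add: A_def)
  \<comment> \<open>Edges of \<open>G\<close> are vertex sets, so an edge of \<open>B\<close> goes
    to its vertex set pulled back along \<open>y\<close>, together with its number in its parallel
    class.\<close>
  define F where "F e = (g ` inc B e, h (g ` inc B e) e)" for e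
  have Fe: "F e = (s, h s e)" if "s \<in> edges G" "e \<in> A s" for s e
    using that gy[OF G(2)] by (simp add: F_def A_def)
  have "bij_betw F (edges B) (edges G \<times> {..<t})"
    unfolding bij_betw_def
  proof
    show "inj_on F (edges B)"
    proof (rule inj_onI)
      fix e e' assume e: "e \<in> edges B" "e' \<in> edges B" "F e = F e'"
      obtain s s' where s: "s \<in> edges G" "e \<in> A s" "s' \<in> edges G" "e' \<in> A s'"
        using coverA[OF e(1)] coverA[OF e(2)] by blast
      then have "(s, h s e) = (s', h s' e')" using Fe[of s e] Fe[of s' e'] e(3) by metis
      then have "s = s'" "h s e = h s e'" by auto
      then show "e = e'" using h[of s] s by (auto simp: bij_betw_def inj_on_def)
    qed
    show "F ` edges B = edges G \<times> {..<t}"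
    proof (rule set_eqI)
      fix p
      show "p \<in> F ` edges B \<longleftrightarrow> p \<in> edges G \<times> {..<t}"
      proof
        assume "p \<in> F ` edges B"
        then obtain e where e: "e \<in> edges B" "p = F e" by blast
        obtain s where s: "s \<in> edges G" "e \<in> A s" using coverA[OF e(1)] by blast
        then have "h s e \<in> {..<t}" using h[of s] by (auto simp: bij_betw_def)
        then show "p \<in> edges G \<times> {..<t}" using e s Fe by simp
      next
        assume "p \<in> edges G \<times> {..<t}"
        then obtain s k where s: "p = (s, k)" "s \<in> edges G" "k \<in> {..<t}" by auto
        have "k \<in> h s ` A s" using h[OF s(2)] s(3) by (simp add: bij_betw_def)
        then obtain e where "e \<in> A s" "h s e = k" by blast
        then have "F e = p" "e \<in> edges B" using s Fe by (auto simp: A_def)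
        then show "p \<in> F ` edges B" by blast
      qed
    qed
  qed
  moreover have "inc (multiple t G) (F e) = g ` inc B e" for e
    by (simp add: multiple_def F_def G(1))
  ultimately show ?thesis
    unfolding hg_iso_def using bg by (intro exI[of _ g] exI[of _ F]) (simp add: multiple_def)
qed

lemma brick_complete:
  assumes B: "hypergraph B" "verts B \<noteq> {}" and t: "0 < t"
    and size: "\<And>e. e \<in> edges B \<Longrightarrow> card (inc B e) = 2"
    and mult: "\<And>u v. u \<in> verts B \<Longrightarrow> v \<in> verts B \<Longrightarrow> u \<noteq> v \<Longrightarrow> card {e \<in> edges B. inc B e = {u, v}} = t"
  shows "brick B"
proof -
  define n where "n = card (verts B)"
  have fin: "finite (verts B)" using B by (simp add: hypergraph_def)
  obtain y where y: "bij_betw y {..<n} (verts B)"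
    using ex_bij_betw_nat_finite[OF fin] by (auto simp: n_def atLeast0LessThan)
  have inj: "inj_on y {..<n}" and im: "y ` {..<n} = verts B" using y by (auto simp: bij_betw_def)
  have "hg_iso B (multiple t (complete_graph n))"
  proof (rule hg_iso_multiple[OF B(1)])
    show "bij_betw y (verts (complete_graph n)) (verts B)" using y by (simp add: complete_graph_def)
    show "\<exists>s\<in>edges (complete_graph n). inc B e = y ` s" if "e \<in> edges B" for e
    proof -
      have "inc B e \<subseteq> y ` {..<n}" using B that im by (auto simp: hypergraph_def)
      then obtain s where s: "s \<subseteq> {..<n}" "inc B e = y ` s" by (auto simp: subset_image_iff)
      then have "card s = 2" using size[OF that] card_image[of y s] inj inj_on_subset by metis
      then show ?thesis using s by (auto simp: complete_graph_def)
    qed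
    show "card {e \<in> edges B. inc B e = y ` s} = t" if "s \<in> edges (complete_graph n)" for s
    proof -
      have s: "s \<subseteq> {..<n}" "card s = 2" using that by (auto simp: complete_graph_def)
      then obtain a b where ab: "s = {a, b}" "a \<noteq> b" by (auto simp: card_2_iff)
      then have "y a \<noteq> y b" "y a \<in> verts B" "y b \<in> verts B"
        using s inj im by (auto simp: inj_on_def)
      then show ?thesis using mult ab by simp
    qed
  qed (auto simp: complete_graph_def)
  moreover have "1 \<le> n" using B fin by (simp add: n_def card_gt_0_iff Suc_le_eq)
  ultimately show ?thesis using t unfolding brick_def by (metis One_nat_def Suc_leI)
qed

lemma brick_odd_cycle:
  fixes x :: "int \<Rightarrow> 'v"
  assumes B: "hypergraph B" and n: "odd n" "4 \<le> n" and t: "0 < t"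
    and size: "\<And>e. e \<in> edges B \<Longrightarrow> card (inc B e) = 2"
    and x: "range x = verts B" "\<And>i j. x i = x j \<longleftrightarrow> n dvd i - j"
    and mult: "\<And>i. card {e \<in> edges B. inc B e = {x i, x (i + 1)}} = t"
    and adj: "\<And>i j e. e \<in> edges B \<Longrightarrow> inc B e = {x i, x j} \<Longrightarrow> n dvd i - j - 1 \<or> n dvd i - j + 1"
  shows "brick B"
proof -
  define m where "m = nat n"
  have m: "n = int m" "3 \<le> m" using n by (auto simp: m_def)
  have om: "odd m" using n(1) m(1) by simp
  define y where "y k = x (int k)" for k
  have xmod: "x (i mod n) = x i" for i by (simp add: x(2) mod_eq_dvd_iff[symmetric])
  have ysuc: "y (Suc k mod m) = x (int k + 1)" for k
    using xmod[of "int k + 1"] m(1) by (simp add: y_def zmod_int add.commute)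
  have ymod: "y (nat (i mod n)) = x i" for i using xmod[of i] n by (simp add: y_def)
  have inj: "inj_on y {..<m}"
  proof (rule inj_onI)
    fix a b assume ab: "a \<in> {..<m}" "b \<in> {..<m}" "y a = y b"
    then have "n dvd int a - int b" by (simp add: y_def x(2))
    then have "int a mod n = int b mod n" by (simp add: mod_eq_dvd_iff)
    then show "a = b" using ab m by simp
  qed
  have im: "y ` {..<m} = verts B"
  proof
    show "y ` {..<m} \<subseteq> verts B" using x(1) by (auto simp: y_def)
    show "verts B \<subseteq> y ` {..<m}"
    proof
      fix v assume "v \<in> verts B"
      then obtain i where "v = x i" using x(1) by auto
      then have "v = y (nat (i mod n))" using ymod by simp
      moreover have "nat (i mod n) < m" using m n by (simp add: nat_less_iff)
      ultimately show "v \<in> y ` {..<m}" by blast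
    qed
  qed
  have "hg_iso B (multiple t (cycle_graph m))"
  proof (rule hg_iso_multiple[OF B(1)])
    show "bij_betw y (verts (cycle_graph m)) (verts B)"
      using inj im by (simp add: cycle_graph_def bij_betw_def)
    show "s \<subseteq> verts (cycle_graph m)" if "s \<in> edges (cycle_graph m)" for s
      using that m(2) by (auto simp: cycle_graph_def)
    show "\<exists>s\<in>edges (cycle_graph m). inc B e = y ` s" if e: "e \<in> edges B" for e
    proof -
      have *: "\<exists>s\<in>edges (cycle_graph m). {x i, x (i + 1)} = y ` s" for i
      proof -
        define k where "k = nat (i mod n)"
        have "y k = x i" using ymod by (simp add: k_def)
        moreover have "y (Suc k mod m) = x (i + 1)"
        proof -
          have "int k = i mod n" using n by (simp add: k_def)
          then have "x (int k + 1) = x (i + 1)"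
            using xmod[of "i mod n + 1"] xmod[of "i + 1"] by (simp add: mod_add_left_eq)
          then show ?thesis using ysuc by simp
        qed
        moreover have "k < m" using m n by (simp add: k_def nat_less_iff)
        ultimately show ?thesis
          by (intro bexI[of _ "{k, Suc k mod m}"]) (auto simp: cycle_graph_def)
      qed
      obtain u v where uv: "inc B e = {u, v}" using size[OF e] by (auto simp: card_2_iff)
      moreover have "inc B e \<subseteq> range x" using B e x(1) by (auto simp: hypergraph_def)
      ultimately obtain i j where ij: "inc B e = {x i, x j}" by auto
      from adj[OF e ij] show ?thesis
      proof
        assume "n dvd i - j - 1"
        then have "x i = x (j + 1)" using x(2)[of i "j + 1"] by (simp add: algebra_simps)
        then show ?thesis using *[of j] ij by (simp add: insert_commute)
      next
        assume "n dvd i - j + 1"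
        then have "x (i + 1) = x j" using x(2)[of "i + 1" j] by (simp add: algebra_simps)
        then show ?thesis using *[of i] ij by simp
      qed
    qed
    show "card {e \<in> edges B. inc B e = y ` s} = t" if s: "s \<in> edges (cycle_graph m)" for s
    proof -
      obtain k where k: "s = {k, Suc k mod m}" using s by (auto simp: cycle_graph_def)
      then have "y ` s = {x (int k), x (int k + 1)}" using ysuc[of k] by (simp add: y_def)
      then show ?thesis using mult by simp
    qed
  qed (simp add: cycle_graph_def)
  then show ?thesis using t m om unfolding brick_def by (metis One_nat_def Suc_leI)
qed

section \<open>Induced subhypergraphs, cuts and blocks\<close>

lemma hypergraph_induced: "hypergraph H \<Longrightarrow> hypergraph (induced H X)"
  by (auto simp: hypergraph_def induced_def)

lemma induced_induced: "X \<subseteq> Y \<Longrightarrow> induced (induced H Y) X = induced H X"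
  by (auto simp: induced_def)

lemma induced_verts: "hypergraph H \<Longrightarrow> induced H (verts H) = H"
  by (cases H) (auto simp: induced_def hypergraph_def)

lemma subhypergraph_induced: "hypergraph H \<Longrightarrow> subhypergraph (induced H X) H"
  using hypergraph_induced[of H X] by (auto simp: subhypergraph_def induced_def)

lemma is_union_induced_iff:
  assumes "hypergraph H" "X \<subseteq> verts H" "Y \<subseteq> verts H"
  shows "is_union H (induced H X) (induced H Y) \<longleftrightarrow>
    verts H = X \<union> Y \<and> (\<forall>e\<in>edges H. inc H e \<subseteq> X \<or> inc H e \<subseteq> Y)"
proof -
  have v: "verts (induced H X) = X" "verts (induced H Y) = Y"
    using assms by (auto simp: induced_def)
  have e: "edges (induced H Z) = {e \<in> edges H. inc H e \<subseteq> Z}" for Z by (simp add: induced_def)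
  show ?thesis
    unfolding is_union_def v e using subhypergraph_induced[OF assms(1)] by blast
qed

lemma edges_empty:
  assumes "hypergraph G" "verts G \<subseteq> {v}" shows "edges G = {}"
proof -
  have False if "e \<in> edges G" for e
  proof -
    have "inc G e \<subseteq> {v}" "2 \<le> card (inc G e)" using that assms by (auto simp: hypergraph_def)
    then show False using card_mono[of "{v}" "inc G e"] by simp
  qed
  then show ?thesis by blast
qed

lemma hg_connected_crossing:
  assumes "hg_connected H" "X \<subseteq> verts H" "X \<noteq> {}" "X \<noteq> verts H"
  shows "\<exists>e\<in>edges H. inc H e \<inter> X \<noteq> {} \<and> inc H e - X \<noteq> {}"
proof (rule ccontr)
  assume no: "\<not> ?thesis"
  obtain u v where uv: "u \<in> X" "v \<in> verts H" "v \<notin> X" "u \<in> verts H" using assms by blast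
  then obtain vs es where p: "hyperpath H vs es" "hd vs = u" "last vs = v"
    using assms(1) unfolding hg_connected_def by blast
  have len: "length vs = Suc (length es)" using p by (simp add: hyperpath_def)
  then have "vs \<noteq> []" by auto
  have "vs ! i \<in> X" if "i \<le> length es" for i
    using that
  proof (induction i)
    case 0
    then show ?case using p uv \<open>vs \<noteq> []\<close> by (simp add: hd_conv_nth)
  next
    case (Suc i)
    then have "{vs ! i, vs ! Suc i} \<subseteq> inc H (es ! i)" "es ! i \<in> edges H"
      using p(1) by (auto simp: hyperpath_def subset_iff)
    then show ?case using no Suc by auto
  qed
  then have "last vs \<in> X" using len \<open>vs \<noteq> []\<close> by (simp add: last_conv_nth)
  then show False using p uv by simp
qed

text \<open>Without a crossing edge, \<open>insert v X\<close> and \<open>verts B - X\<close> would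
  be two parts that \<open>v\<close> separates.\<close>

lemma nonseparable_crossing:
  assumes "hypergraph B" and ns: "\<not> separating_vertex B v"
    and v: "v \<in> verts B" "X \<subseteq> verts B - {v}" "X \<noteq> {}" "X \<noteq> verts B - {v}"
  shows "\<exists>e\<in>edges B. inc B e \<inter> X \<noteq> {} \<and> inc B e - X - {v} \<noteq> {}"
proof (rule ccontr)
  assume no: "\<not> ?thesis"
  define Y where "Y = verts B - X"
  have fin: "finite (verts B)" using assms by (simp add: hypergraph_def)
  have card2: "2 \<le> card Z" if Z: "Z \<subseteq> verts B" "v \<in> Z" "Z \<noteq> {v}" for Z
  proof -
    have "finite Z" using Z fin finite_subset by blast
    obtain z where "z \<in> Z" "z \<noteq> v" using Z by blast
    then have "card {v, z} \<le> card Z" using Z \<open>finite Z\<close> by (intro card_mono) auto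
    then show ?thesis using \<open>z \<noteq> v\<close> by simp
  qed
  have "inc B e \<subseteq> insert v X \<or> inc B e \<subseteq> Y" if "e \<in> edges B" for e
  proof -
    have "inc B e \<subseteq> verts B" using assms(1) that by (simp add: hypergraph_def)
    then show ?thesis using no that unfolding Y_def by blast
  qed
  moreover have "verts B = insert v X \<union> Y" "insert v X \<subseteq> verts B" "Y \<subseteq> verts B"
    using v by (auto simp: Y_def)
  ultimately have "is_union B (induced B (insert v X)) (induced B Y)"
    using is_union_induced_iff[OF assms(1)] by blast
  moreover have "2 \<le> card (insert v X)" by (rule card2) (use v in auto)
  moreover have "2 \<le> card Y" by (rule card2) (use v in \<open>auto simp: Y_def\<close>)
  moreover have "insert v X \<inter> Y = {v}" "insert v X \<subseteq> verts B" "Y \<subseteq> verts B"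
    using v by (auto simp: Y_def)
  ultimately show False using ns unfolding separating_vertex_def by blast
qed

lemma subhypergraph_inc:
  assumes "subhypergraph B H" "e \<in> edges B"
  shows "inc B e = inc H e" "inc H e \<subseteq> verts B" "e \<in> edges H"
proof -
  show eq: "inc B e = inc H e" and "e \<in> edges H" using assms by (auto simp: subhypergraph_def)
  have "hypergraph B" using assms by (simp add: subhypergraph_def)
  then have "inc B e \<subseteq> verts B" using assms(2) by (simp add: hypergraph_def)
  then show "inc H e \<subseteq> verts B" by (simp only: eq)
qed

lemma subhypergraph_of_induced:
  assumes "subhypergraph B H" shows "subhypergraph B (induced H (verts B))"
  using assms subhypergraph_inc[OF assms] by (simp add: subhypergraph_def induced_def subset_iff)

text \<open>Adding edges on the same vertex set keeps all hyperpaths, and a separation of the larger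
  hypergraph is also one of the smaller.\<close>

lemma nonseparable_induced:
  assumes H: "hypergraph H" and B: "subhypergraph B H" "nonseparable B"
  shows "nonseparable (induced H (verts B))"
  unfolding nonseparable_def
proof
  let ?B = "induced H (verts B)"
  have V: "verts ?B = verts B" using B by (auto simp: induced_def subhypergraph_def)
  have E: "edges B \<subseteq> edges ?B" "\<And>e. e \<in> edges B \<Longrightarrow> inc B e = inc ?B e"
    using subhypergraph_inc[OF B(1)] by (auto simp: induced_def)
  have hB: "hypergraph B" using B by (simp add: subhypergraph_def)
  have "hyperpath ?B vs es" if "hyperpath B vs es" for vs es
  proof -
    have "inc ?B (es ! i) = inc B (es ! i)" if "i < length es" for i
      using E(2)[of "es ! i"] \<open>hyperpath B vs es\<close> that by (auto simp: hyperpath_def subset_iff)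
    then show ?thesis using that V E(1) by (auto simp: hyperpath_def)
  qed
  then show "hg_connected ?B" using B(2) V unfolding nonseparable_def hg_connected_def by metis
  show "\<nexists>v. separating_vertex ?B v"
  proof
    assume "\<exists>v. separating_vertex ?B v"
    then obtain v X Y where XY: "X \<subseteq> verts B" "Y \<subseteq> verts B" "is_union ?B (induced ?B X) (induced ?B Y)"
      "X \<inter> Y = {v}" "2 \<le> card X" "2 \<le> card Y"
      unfolding separating_vertex_def V by blast
    have "X \<subseteq> verts ?B" "Y \<subseteq> verts ?B" using XY V by simp_all
    note un = is_union_induced_iff[OF hypergraph_induced[OF H] this, THEN iffD1, OF XY(3)]
    have "inc B e \<subseteq> X \<or> inc B e \<subseteq> Y" if "e \<in> edges B" for e
    proof -
      have "e \<in> edges ?B" using E that by blast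
      then have "inc ?B e \<subseteq> X \<or> inc ?B e \<subseteq> Y" using un by blast
      then show ?thesis using E(2)[OF that] by simp
    qed
    moreover have "verts B = X \<union> Y" using un V by simp
    ultimately have "is_union B (induced B X) (induced B Y)"
      using is_union_induced_iff[OF hB] XY(1,2) by simp
    then show False using B(2) XY unfolding nonseparable_def separating_vertex_def by blast
  qed
qed

text \<open>Blocks are defined among all subhypergraphs; maximality against the induced one on the
  same vertices shows that a block is induced.\<close>

lemma block_edges:
  assumes "hypergraph H" "is_block H B"
  shows "edges B = {e \<in> edges H. inc H e \<subseteq> verts B}"
proof -
  have B: "subhypergraph B H" "nonseparable B" using assms by (auto simp: is_block_def)
  have "subhypergraph B (induced H (verts B))" using B(1) by (rule subhypergraph_of_induced)
  then have "subhypergraph (induced H (verts B)) B"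
    using assms nonseparable_induced[OF assms(1) B] subhypergraph_induced[OF assms(1)]
    unfolding is_block_def by blast
  then have "{e \<in> edges H. inc H e \<subseteq> verts B} \<subseteq> edges B"
    by (auto simp: subhypergraph_def induced_def)
  moreover have "edges B \<subseteq> {e \<in> edges H. inc H e \<subseteq> verts B}"
    using subhypergraph_inc[OF B(1)] by blast
  ultimately show ?thesis by blast
qed

text \<open>The empty hypergraph is vacuously nonseparable; it fails to be maximal because a single
  vertex of \<open>H\<close> is nonseparable too.\<close>

lemma block_nonempty:
  assumes "hypergraph H" "is_block H B" "verts H \<noteq> {}"
  shows "verts B \<noteq> {}"
proof
  assume empty: "verts B = {}"
  obtain v where v: "v \<in> verts H" using assms by blast
  have B: "subhypergraph B H" using assms by (simp add: is_block_def)
  then have "edges B = {}" using edges_empty[of B undefined] empty by (simp add: subhypergraph_def)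
  let ?K = "induced H {v}"
  have K: "verts ?K = {v}" using v by (auto simp: induced_def)
  have sub: "subhypergraph B ?K"
    using B empty \<open>edges B = {}\<close> by (simp add: subhypergraph_def)
  have "hyperpath ?K [v] []" using K by (simp add: hyperpath_def)
  then have "hg_connected ?K" unfolding hg_connected_def K by (metis last.simps list.sel(1) singletonD)
  moreover have "\<not> separating_vertex ?K u" for u
  proof
    assume "separating_vertex ?K u"
    then obtain X where "X \<subseteq> {v}" "2 \<le> card X" unfolding separating_vertex_def K by blast
    then show False using card_mono[of "{v}" X] by simp
  qed
  ultimately have "nonseparable ?K" by (simp add: nonseparable_def)
  then have "subhypergraph ?K B"
    using assms(2) sub subhypergraph_induced[OF assms(1)] unfolding is_block_def by blast
  then show False using K empty by (simp add: subhypergraph_def)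
qed

section \<open>Critical hypergraphs of a property\<close>

locale hypergraph_class =
  fixes P :: "('v, 'e) pre_hypergraph set"
  assumes property: "hypergraph_property P" and nontriv: "nontrivial P"
    and hered: "hereditary P" and additive: "hg_additive P"
begin

lemma edgeless_iso:
  assumes "G \<in> P" "hypergraph H" "edges G = {}" "edges H = {}" "bij_betw g (verts G) (verts H)"
  shows "H \<in> P"
proof -
  have "hg_iso G H" using assms unfolding hg_iso_def
    by (intro exI[of _ g] exI[of _ id]) (simp add: bij_betw_def)
  then show ?thesis using property assms unfolding hypergraph_property_def by blast
qed

text \<open>A member with a vertex \<open>u\<close> has its restrictions to \<open>{}\<close> and
  \<open>{u}\<close> in \<open>P\<close>, and an edgeless hypergraph on at most one vertex is
  isomorphic to one of these.\<close>

lemma small_mem: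
  assumes "hypergraph G" "verts G \<subseteq> {v}" shows "G \<in> P"
proof -
  obtain H u where H: "H \<in> P" "u \<in> verts H" using nontriv by (auto simp: nontrivial_def)
  have hH: "hypergraph H" using H property by (simp add: hypergraph_property_def)
  define X where "X = (if verts G = {} then {} else {u})"
  have X: "X \<subseteq> verts H" "X \<subseteq> {u}" using H by (auto simp: X_def)
  have K: "induced H X \<in> P" using hered H X by (simp add: hereditary_def)
  have vK: "verts (induced H X) = X" using X by (auto simp: induced_def)
  have "edges (induced H X) = {}" "edges G = {}"
    using edges_empty[OF hypergraph_induced[OF hH], of X u] edges_empty[OF assms] X vK by auto
  moreover have "bij_betw (\<lambda>_. v) (verts (induced H X)) (verts G)"
    using assms(2) unfolding vK by (auto simp: X_def bij_betw_def)
  ultimately show ?thesis using edgeless_iso[OF K assms(1)] by blast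
qed

text \<open>A vertex set of least cardinality inducing a non-member works; \<open>small_mem\<close>
  shows that it is not empty.\<close>

lemma critical_subset:
  assumes "hypergraph G" "G \<notin> P"
  obtains T where "T \<subseteq> verts G" "T \<noteq> {}" "induced G T \<in> critical_class P"
proof -
  let ?Q = "\<lambda>T. T \<subseteq> verts G \<and> induced G T \<notin> P"
  have "?Q (verts G)" using assms induced_verts[OF assms(1)] by simp
  then obtain T where T: "?Q T" "\<And>S. ?Q S \<Longrightarrow> card T \<le> card S"
    using ex_has_least_nat[of ?Q "verts G" card] by blast
  have vT: "verts (induced G T) = T" using T by (auto simp: induced_def)
  have h: "hypergraph (induced G T)" using assms(1) by (rule hypergraph_induced)
  have "T \<noteq> {}" using small_mem[OF h, of undefined] T vT by auto
  moreover have "del_vert (induced G T) v \<in> P" if "v \<in> T" for v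
  proof -
    have "finite T" using h vT by (auto simp: hypergraph_def)
    then have "card (T - {v}) < card T" using that by (intro psubset_card_mono) auto
    then have "induced G (T - {v}) \<in> P" using T(2)[of "T - {v}"] T(1) by fastforce
    then show ?thesis using induced_induced[of "T - {v}" T G] by (simp add: del_vert_def vT)
  qed
  ultimately show ?thesis using that[of T] T h vT by (simp add: critical_class_def)
qed

lemma critical_degree_le:
  assumes "K \<in> critical_class P" "v \<in> verts K"
  shows "critical_degree P \<le> degree K v"
proof -
  have "critical_degree P \<le> min_degree K"
    unfolding critical_degree_def using assms by (intro Least_le) blast
  also have "\<dots> \<le> degree K v"
    unfolding min_degree_def using assms by (intro Min_le) (auto simp: critical_class_def hypergraph_def)
  finally show ?thesis .
qed

text \<open>The bridge from degeneracy to \<open>P\<close>: a non-member contains an induced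
  critical hypergraph, all of whose degrees are at least \<open>critical_degree P\<close>.\<close>

lemma mem_if_degenerate:
  assumes "hypergraph G"
    and "\<And>T. T \<subseteq> verts G \<Longrightarrow> T \<noteq> {} \<Longrightarrow> \<exists>v\<in>T. degree (induced G T) v < critical_degree P"
  shows "G \<in> P"
proof (rule ccontr)
  assume "G \<notin> P"
  then obtain T where T: "T \<subseteq> verts G" "T \<noteq> {}" "induced G T \<in> critical_class P"
    using critical_subset assms(1) by blast
  obtain v where v: "v \<in> T" "degree (induced G T) v < critical_degree P" using assms(2) T by blast
  have "v \<in> verts (induced G T)" using v T by (auto simp: induced_def)
  then show False using critical_degree_le[OF T(3)] v by fastforce
qed

text \<open>A critical hypergraph with an isolated vertex is the disjoint union of that vertex and
  the rest, both in \<open>P\<close>; this is where additivity enters.\<close>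

lemma critical_degree_pos: "0 < critical_degree P"
proof (rule ccontr)
  assume "\<not> 0 < critical_degree P"
  then have zero: "critical_degree P = 0" by simp
  obtain G where "hypergraph G" "G \<notin> P" using nontriv by (auto simp: nontrivial_def)
  then obtain T where "induced G T \<in> critical_class P" using critical_subset by blast
  then have "\<exists>d. \<exists>K\<in>critical_class P. min_degree K = d" by blast
  then have "\<exists>K\<in>critical_class P. min_degree K = critical_degree P"
    unfolding critical_degree_def by (rule LeastI_ex)
  then obtain K where K: "K \<in> critical_class P" "min_degree K = 0" using zero by auto
  have hK: "hypergraph K" "K \<notin> P" using K by (auto simp: critical_class_def)
  have "verts K \<noteq> {}" using small_mem[OF hK(1), of undefined] hK by auto
  then have "min_degree K \<in> degree K ` verts K"
    unfolding min_degree_def using hK by (intro Min_in) (auto simp: hypergraph_def)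
  then obtain v where v: "v \<in> verts K" "degree K v = 0" using K by auto
  have iso: "v \<notin> inc K e" if "e \<in> edges K" for e
  proof -
    have "finite {e \<in> edges K. v \<in> inc K e}" using hK by (simp add: hypergraph_def)
    then show ?thesis using v that by (auto simp: degree_def)
  qed
  have "is_union K (del_vert K v) (induced K {v})"
    unfolding del_vert_def
    using iso v hK by (subst is_union_induced_iff) (auto simp: hypergraph_def)
  moreover have "del_vert K v \<in> P" using K v by (simp add: critical_class_def)
  moreover have "induced K {v} \<in> P"
    by (rule small_mem[OF hypergraph_induced[OF hK(1)], of _ v]) (auto simp: induced_def)
  moreover have "verts (del_vert K v) \<inter> verts (induced K {v}) = {}"
    by (auto simp: del_vert_def induced_def)
  ultimately have "K \<in> P" using additive hK unfolding hg_additive_def by blast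
  then show False using hK by blast
qed

text \<open>A connected hypergraph of maximum degree at most \<open>d(P)\<close> outside \<open>P\<close> is itself critical, since no
  edge can leave a critical induced subhypergraph.\<close>

lemma low_degree_block:
  assumes B: "hypergraph B" "hg_connected B" "verts B \<noteq> {}"
    and le: "\<And>v. v \<in> verts B \<Longrightarrow> degree B v \<le> critical_degree P"
  shows "(B \<in> critical_class P \<and> regular (critical_degree P) B) \<or>
    (B \<in> P \<and> max_degree B \<le> critical_degree P)"
proof (cases "B \<in> P")
  case True
  have "finite (verts B)" using B by (simp add: hypergraph_def)
  then show ?thesis using True B le by (simp add: max_degree_def)
next
  case False
  then obtain T where T: "T \<subseteq> verts B" "T \<noteq> {}" "induced B T \<in> critical_class P"
    using critical_subset B(1) by blast
  have fin: "finite (edges B)" using B by (simp add: hypergraph_def)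
  have vT: "verts (induced B T) = T" using T by (auto simp: induced_def)
  have "T = verts B"
  proof (rule ccontr)
    assume "T \<noteq> verts B"
    then obtain e where e: "e \<in> edges B" "inc B e \<inter> T \<noteq> {}" "inc B e - T \<noteq> {}"
      using hg_connected_crossing[OF B(2) T(1,2)] by blast
    obtain v where v: "v \<in> inc B e" "v \<in> T" using e by blast
    have "{e \<in> edges (induced B T). v \<in> inc (induced B T) e} \<subset> {e \<in> edges B. v \<in> inc B e}"
      using e v by (auto simp: induced_def)
    then have "degree (induced B T) v < degree B v"
      unfolding degree_def using fin by (intro psubset_card_mono) auto
    also have "\<dots> \<le> critical_degree P" using le T v by blast
    finally show False using critical_degree_le[OF T(3)] v vT by fastforce
  qed
  then have "B \<in> critical_class P" using T induced_verts[OF B(1)] by simp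
  moreover from this have "regular (critical_degree P) B"
    using critical_degree_le[of B] le unfolding regular_def by (meson le_antisym)
  ultimately show ?thesis by blast
qed

end

theorem theorem1p6:
  fixes P :: "('v::infinite, 'e::infinite) pre_hypergraph set"
    and H :: "('v, 'e) pre_hypergraph"
    and C :: "'c set" and L :: "'v \<Rightarrow> 'c set" and r :: nat
  assumes "hypergraph_property P"
    and "nontrivial P" and "hereditary P" and "hg_additive P"
    and "critical_degree P = r"
    and "hypergraph H" and "hg_connected H"
    and "list_assignment H C L"
    and "\<forall>v\<in>verts H. list_size_ge r (L v) (degree H v)"
    and "\<not> list_colorable P H C L"
  shows "\<forall>B. is_block H B \<longrightarrow>
    brick B \<or> (B \<in> critical_class P \<and> regular r B) \<or> (B \<in> P \<and> max_degree B \<le> r)"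
proof (intro allI impI)
  fix B assume block: "is_block H B"
  interpret hypergraph_class P by unfold_locales (use assms in auto)
  note H = \<open>hypergraph H\<close>
  have r: "0 < r" using critical_degree_pos assms(5) by simp
  \<comment> \<open>Finite sublists keep \<open>K\<close> finite. An infinite list is cut down to as
    many colours as the degree, which suffices because \<open>r\<close> is positive.\<close>
  have "\<exists>A. finite A \<and> A \<subseteq> L v \<and> degree H v \<le> r * card A" if v: "v \<in> verts H" for v
  proof (cases "finite (L v)")
    case True
    then show ?thesis using assms(9) v by (auto simp: list_size_ge_def)
  next
    case False
    then obtain A where "finite A" "card A = degree H v" "A \<subseteq> L v"
      using infinite_arbitrarily_large by blast
    then show ?thesis using r by (intro exI[of _ A]) simp
  qed
  then obtain A where A: "\<And>v. v \<in> verts H \<Longrightarrow> finite (A v) \<and> A v \<subseteq> L v \<and> degree H v \<le> r * card (A v)"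
    by metis
  define K where "K = (\<Union>v\<in>verts H. A v)"
  define f where "f c v = (if v \<in> verts H \<and> c \<in> A v then r else 0)" for c v
  have fin: "finite (verts H)" "finite (edges H)" using H by (auto simp: hypergraph_def)
  interpret W: weighted_hypergraph "verts H" "edges H" "inc H" K f
  proof
    show "finite K" unfolding K_def using fin A by auto
    show "inc H e \<subseteq> verts H" "2 \<le> card (inc H e)" if "e \<in> edges H" for e
      using H that by (auto simp: hypergraph_def)
    show "f c v = 0" if "c \<notin> K" for c v using that by (auto simp: f_def K_def)
    show "card {e \<in> edges H. v \<in> inc H e} \<le> (\<Sum>c\<in>K. f c v)" if v: "v \<in> verts H" for v
    proof -
      have "(\<Sum>c\<in>K. f c v) = (\<Sum>c\<in>A v. f c v)"
        by (rule sum.mono_neutral_right) (use \<open>finite K\<close> v in \<open>auto simp: f_def K_def\<close>)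
      also have "\<dots> = r * card (A v)" using v by (simp add: f_def)
      finally show ?thesis using A[OF v] by (simp add: degree_def)
    qed
    show "\<exists>e\<in>edges H. inc H e \<inter> X \<noteq> {} \<and> inc H e - X \<noteq> {}"
      if "X \<subseteq> verts H" "X \<noteq> {}" "X \<noteq> verts H" for X
      using hg_connected_crossing[OF assms(7) that] .
  qed (use fin in auto)
  have noncol: "\<not> W.proper \<phi> (verts H)" for \<phi>
  proof
    assume \<phi>: "W.proper \<phi> (verts H)"
    have cl: "\<exists>v\<in>T. W.dg T v < f c v" if "T \<subseteq> {v \<in> verts H. \<phi> v = c}" "T \<noteq> {}" for c T
      using \<phi> that unfolding W.proper_def W.degenerate_def by blast
    have "\<phi> v \<in> L v" if v: "v \<in> verts H" for v
      \<comment> \<open>The singleton \<open>{v}\<close> demands a positive budget for the colour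
        \<open>\<phi> v\<close>, which only colours in \<open>A v\<close> have.\<close>
      using cl[of "{v}" "\<phi> v"] v A[OF v] by (auto simp: f_def split: if_splits)
    moreover have "induced H {v \<in> verts H. \<phi> v = c} \<in> P" for c
    proof (rule mem_if_degenerate)
      let ?S = "{v \<in> verts H. \<phi> v = c}"
      show "hypergraph (induced H ?S)" using H by (rule hypergraph_induced)
      fix T assume "T \<subseteq> verts (induced H ?S)" and ne: "T \<noteq> {}"
      then have T: "T \<subseteq> ?S" by (auto simp: induced_def)
      obtain v where v: "v \<in> T" "W.dg T v < f c v" using cl[OF T ne] by blast
      have "degree (induced (induced H ?S) T) v = W.dg T v"
        unfolding induced_induced[OF T]
        by (auto simp: degree_def induced_def W.dg_def intro!: arg_cong[where f = card])
      moreover have "f c v \<le> r" by (simp add: f_def)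
      ultimately show "\<exists>v\<in>T. degree (induced (induced H ?S) T) v < critical_degree P"
        using v assms(5) by (intro bexI[of _ v]) auto
    qed
    ultimately have "is_list_coloring P H C L \<phi>" by (simp add: is_list_coloring_def)
    then show False using assms(10) by (auto simp: list_colorable_def)
  qed
  have "verts H \<noteq> {}" using noncol by (auto simp: W.proper_def W.degenerate_def)
  then have Bne: "verts B \<noteq> {}" using block_nonempty[OF H block] by blast
  have sub: "subhypergraph B H" and ns: "hg_connected B" "\<And>v. \<not> separating_vertex B v"
    using block by (auto simp: is_block_def nonseparable_def)
  have hB: "hypergraph B" and VB: "verts B \<subseteq> verts H" and IB: "\<And>e. e \<in> edges B \<Longrightarrow> inc B e = inc H e"
    using sub by (auto simp: subhypergraph_def)
  have EB: "edges B = {e \<in> edges H. inc H e \<subseteq> verts B}" by (rule block_edges[OF H block])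
  obtain \<phi> where \<phi>: "W.proper \<phi> (verts H - verts B)" using W.greedy[OF VB Bne] by blast
  define f' where "f' c v = f c v -
    card {e \<in> edges H. v \<in> inc H e \<and> \<not> inc H e \<subseteq> verts B \<and> (\<forall>x\<in>inc H e - verts B. \<phi> x = c)}" for c v
  have "noncolorable_block (verts B) {e \<in> edges H. inc H e \<subseteq> verts B} (inc H) K f'"
    unfolding f'_def
  proof (rule W.restrict[OF VB \<phi> noncol])
    show "\<exists>e\<in>edges H. inc H e \<subseteq> verts B \<and> inc H e \<inter> X \<noteq> {} \<and> inc H e - X \<noteq> {}"
      if "X \<subseteq> verts B" "X \<noteq> {}" "X \<noteq> verts B" for X
      using hg_connected_crossing[OF ns(1) that] EB IB by auto
    show "\<exists>e\<in>edges H. inc H e \<subseteq> verts B \<and> inc H e \<inter> X \<noteq> {} \<and> inc H e - X - {v} \<noteq> {}"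
      if "v \<in> verts B" "X \<subseteq> verts B - {v}" "X \<noteq> {}" "X \<noteq> verts B - {v}" for v X
      using nonseparable_crossing[OF hB ns(2) that] EB IB by auto
  qed
  then interpret N: noncolorable_block "verts B" "edges B" "inc H" K f' using EB by simp
  \<comment> \<open>\<open>inc B\<close> and \<open>inc H\<close> are known to agree only on the
    edges of \<open>B\<close>, so edge counts have to be transferred from one to the other.\<close>
  have count: "card {e \<in> edges B. Q (inc H e)} = card {e \<in> edges B. Q (inc B e)}" for Q
    using IB by (intro arg_cong[where f = card]) auto
  from Bne show "brick B \<or> (B \<in> critical_class P \<and> regular r B) \<or> (B \<in> P \<and> max_degree B \<le> r)"
  proof (cases rule: N.block_structure)
    case (mono c)
    have "degree B v \<le> r" if v: "v \<in> verts B" for v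
    proof -
      have "degree B v \<le> f' c v"
        using mono[OF v] count[of "\<lambda>s. v \<in> s"] by (simp add: degree_def)
      also have "\<dots> \<le> r" by (simp add: f'_def f_def)
      finally show ?thesis .
    qed
    then show ?thesis using low_degree_block[OF hB ns(1) Bne] assms(5) by simp
  next
    case (complete t)
    have "brick B"
    proof (rule brick_complete[OF hB Bne complete(1)])
      show "card (inc B e) = 2" if "e \<in> edges B" for e using complete(2) IB that by simp
      show "card {e \<in> edges B. inc B e = {u, v}} = t"
        if "u \<in> verts B" "v \<in> verts B" "u \<noteq> v" for u v
        using complete(3)[OF that] count[of "\<lambda>s. s = {u, v}"] by simp
    qed
    then show ?thesis by blast
  next
    case (odd_cycle n t x)
    have "brick B"
    proof (rule brick_odd_cycle[OF hB odd_cycle(1-3) _ odd_cycle(5,6)])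
      show "card (inc B e) = 2" if "e \<in> edges B" for e using odd_cycle(4) IB that by simp
      show "card {e \<in> edges B. inc B e = {x i, x (i + 1)}} = t" for i
        using odd_cycle(7)[of i] count[of "\<lambda>s. s = {x i, x (i + 1)}"] by simp
      show "n dvd i - j - 1 \<or> n dvd i - j + 1" if "e \<in> edges B" "inc B e = {x i, x j}" for i j e
        using odd_cycle(8)[of e i j] IB[of e] that by simp
    qed
    then show ?thesis by blast
  qed
qed

end
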